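(* Let $\mu$ and $\tilde\mu$ be two probability measures supported on a compact interval $I\subset\mathbb{R}$, with $\mu$ satisfying the standing assumptions below. Let $\nu^{(k)}$ be a solution to $\min_{\lambda\in\mathcal{P}_k(\mathbb{R})}W_1(\mu,\lambda)$ with support points $y_1\le\dots\le y_k$, let $\tilde y_1\le\dots\le\tilde y_k$ be the support points of a solution to $\min_{\lambda\in\mathcal{P}_k(\mathbb{R})}W_1(\tilde\mu,\lambda)$, and set $\vec v_\mu=(F_\mu(y_j))_{j\in[k]}$ and $\vec v_{\tilde\mu}=(F_{\tilde\mu}(\tilde y_j))_{j\in[k]}$. Let $\vec X_n$ be $n$ i.i.d. random variables with law $\mu$. Then \[ \lim_{n\to\infty}\Bigg|\frac{\mathbb{E}[SC_{\vec v_{\tilde\mu}}(\vec X_n)]}{\mathbb{E}[SC_{opt}(\vec X_n)]}-1\Bigg|\le\frac{W_\infty(\mu,\tilde\mu)+2W_1(\mu,\tilde\mu)}{W_1(\mu,\nu^{(k)})}\le 3\,\frac{W_\infty(\mu,\tilde\mu)}{W_1(\mu,\nu^{(k)})}. \] Moreover, for every $n>k$ there exists a constant $C>0$ such that \[ \big|B^{(n)}_{ar}(\mathcal{PM}_{\vec v_\mu})-B^{(n)}_{ar}(\mathcal{PM}_{\vec v_{\tilde\mu}})\big|\le 3\,\frac{W_\infty(\mu,\tilde\mu)}{W_1(\mu,\nu^{(k)})}+\frac{C}{\sqrt n}. \]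
   Context: For $\vec x\in\mathbb{R}^n$, $\vec y\in\mathbb{R}^k$: $SC(\vec x,\vec y)=\frac1n\sum_i\min_j|x_i-y_j|$, $SC_{opt}(\vec x)=\min_{\vec y}SC(\vec x,\vec y)$. A percentile vector is $\vec v$ with $0\le v_1\le\dots\le v_k\le1$; $\mathcal{PM}_{\vec v}$ sorts the reports $x_{(1)}\le\dots\le x_{(n)}$ and places facility $j$ at $x_{(\lfloor(n-1)v_j\rfloor+1)}$; $SC_{\vec v}(\vec x)$ is the Social Cost of its output. $B^{(n)}_{ar}(f)=\mathbb{E}[SC_f(\vec X_n)]/\mathbb{E}[SC_{opt}(\vec X_n)]$, expectations with respect to the agents' true law $\mu$. $\mathcal{P}_k(\mathbb{R})$: probability measures $\sum_{j=1}^k\nu_j\delta_{x_j}$ ($\nu_j\ge0$, $\sum\nu_j=1$). $W_1(\alpha,\beta)=\min_{\pi\in\Pi(\alpha,\beta)}\int|x-y|d\pi$ and $W_\infty(\alpha,\beta)=\min_{\pi\in\Pi(\alpha,\beta)}\max_{(x,y)\in\mathrm{spt}(\pi)}|x-y|$, $\Pi(\alpha,\beta)$ being the couplings. $F_\eta$ denotes the c.d.f. of $\eta$. Standing assumptions on $\mu$: absolutely continuous with density $\rho_\mu$; support an interval on whose interior $\rho_\mu>0$; $\rho_\mu$ differentiable on the support. *)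

theory Defs
  imports "HOL-Probability.Probability"
begin

definition couplings :: "real measure \<Rightarrow> real measure \<Rightarrow> (real \<times> real) measure set" where
  "couplings \<alpha> \<beta> = {\<pi>. sets \<pi> = sets (borel \<Otimes>\<^sub>M borel) \<and> prob_space \<pi> \<and>
      distr \<pi> borel fst = \<alpha> \<and> distr \<pi> borel snd = \<beta>}"

definition spt :: "'a::topological_space measure \<Rightarrow> 'a set" where
  "spt M = {z. \<forall>U. open U \<longrightarrow> z \<in> U \<longrightarrow> emeasure M U > 0}"

definition W1 :: "real measure \<Rightarrow> real measure \<Rightarrow> real" where
  "W1 \<alpha> \<beta> = enn2real (INF \<pi>\<in>couplings \<alpha> \<beta>. \<integral>\<^sup>+ z. ennreal \<bar>fst z - snd z\<bar> \<partial>\<pi>)"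

definition Winf :: "real measure \<Rightarrow> real measure \<Rightarrow> real" where
  "Winf \<alpha> \<beta> = real_of_ereal (INF \<pi>\<in>couplings \<alpha> \<beta>. SUP z\<in>spt \<pi>. ereal \<bar>fst z - snd z\<bar>)"

definition Pk :: "nat \<Rightarrow> real measure set" where
  "Pk k = {l. prob_space l \<and> sets l = sets borel \<and>
      (\<exists>S. finite S \<and> card S \<le> k \<and> emeasure l S = 1)}"

definition W1_opt_k :: "nat \<Rightarrow> real measure \<Rightarrow> real measure \<Rightarrow> bool" where
  "W1_opt_k k \<mu> \<nu> \<longleftrightarrow> \<nu> \<in> Pk k \<and> (\<forall>l\<in>Pk k. W1 \<mu> \<nu> \<le> W1 \<mu> l)"

definition support_points :: "nat \<Rightarrow> real measure \<Rightarrow> (nat \<Rightarrow> real) \<Rightarrow> bool" where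
  "support_points k \<nu> y \<longleftrightarrow> (\<forall>j\<in>{1..<k}. y j \<le> y (Suc j)) \<and>
      (\<forall>j\<in>{1..k}. emeasure \<nu> {y j} > 0) \<and> emeasure \<nu> (y ` {1..k}) = 1"

text \<open>Reports x_0..x_{n-1}, facilities y_1..y_k.\<close>
definition SC :: "nat \<Rightarrow> nat \<Rightarrow> (nat \<Rightarrow> real) \<Rightarrow> (nat \<Rightarrow> real) \<Rightarrow> real" where
  "SC n k x y = (\<Sum>i<n. Min ((\<lambda>j. \<bar>x i - y j\<bar>) ` {1..k})) / real n"

definition SC_opt :: "nat \<Rightarrow> nat \<Rightarrow> (nat \<Rightarrow> real) \<Rightarrow> real" where
  "SC_opt n k x = (INF y. SC n k x y)"

definition ordstat :: "nat \<Rightarrow> (nat \<Rightarrow> real) \<Rightarrow> nat \<Rightarrow> real" where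
  "ordstat n x m = sort (map x [0..<n]) ! (m - 1)"

definition PM :: "nat \<Rightarrow> (nat \<Rightarrow> real) \<Rightarrow> (nat \<Rightarrow> real) \<Rightarrow> (nat \<Rightarrow> real)" where
  "PM n v x = (\<lambda>j. ordstat n x (nat \<lfloor>(real n - 1) * v j\<rfloor> + 1))"

definition SC_PM :: "nat \<Rightarrow> nat \<Rightarrow> (nat \<Rightarrow> real) \<Rightarrow> (nat \<Rightarrow> real) \<Rightarrow> real" where
  "SC_PM n k v x = SC n k x (PM n v x)"

definition sample :: "real measure \<Rightarrow> nat \<Rightarrow> (nat \<Rightarrow> real) measure" where
  "sample \<mu> n = PiM {..<n} (\<lambda>_. \<mu>)"

definition Bar :: "nat \<Rightarrow> nat \<Rightarrow> real measure \<Rightarrow> (nat \<Rightarrow> real) \<Rightarrow> real" where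
  "Bar n k \<mu> v = (\<integral>x. SC_PM n k v x \<partial>sample \<mu> n) / (\<integral>x. SC_opt n k x \<partial>sample \<mu> n)"

definition standing :: "real measure \<Rightarrow> (real \<Rightarrow> real) \<Rightarrow> bool" where
  "standing \<mu> \<rho> \<longleftrightarrow> prob_space \<mu> \<and> \<rho> \<in> borel_measurable borel \<and> (\<forall>x. \<rho> x \<ge> 0) \<and>
     \<mu> = density lborel (\<lambda>x. ennreal (\<rho> x)) \<and> is_interval (spt \<mu>) \<and>
     (\<forall>x\<in>interior (spt \<mu>). \<rho> x > 0) \<and> \<rho> differentiable_on spt \<mu>"

end

theory Submission
  imports Defs
begin

text \<open>
Optimal transport to a measure with \<open>k\<close> atoms is nearest-point assignment, so an optimal \<open>\<nu>\<close> amounts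
to points \<open>p\<close> minimising the cost \<open>\<integral> min\<^sub>j \<bar>x - p\<^sub>j\<bar> d\<mu>\<close>, and \<open>W\<^sub>1(\<mu>, \<nu>)\<close> is that minimum.
This cost is 1-Lipschitz in \<open>\<mu>\<close> for \<open>W\<^sub>1\<close> and in \<open>p\<close> for the maximum norm.

Let \<open>q\<^sub>j\<close> be the \<open>\<mu>\<close>-quantile at the level \<open>F\<^sub>\<mu>\<^sub>'(y'\<^sub>j)\<close>. It lies within \<open>W\<^sub>\<infinity>(\<mu>, \<mu>')\<close> of a point
\<open>z\<^sub>j \<le> y'\<^sub>j\<close> such that \<open>\<mu>'\<close> has no mass in \<open>(z\<^sub>j, y'\<^sub>j]\<close>. Since \<open>y'\<^sub>j\<close> is a median of its cell, replacing
\<open>y'\<close> by \<open>z\<close> keeps the \<open>\<mu>'\<close>-cost optimal. Passing from \<open>q\<close> to \<open>z\<close> and from \<open>\<mu>\<close> to \<open>\<mu>'\<close> and back shows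
that \<open>q\<close> exceeds the optimal \<open>\<mu>\<close>-cost by at most \<open>W\<^sub>\<infinity> + 2 W\<^sub>1\<close>.

The mechanism places its facilities at sample quantiles. By Chebyshev's inequality these converge to
\<open>q\<close>, at rate \<open>n\<^sup>-\<^sup>1\<^sup>/\<^sup>2\<close> at levels strictly between 0 and 1. At the levels 0 and 1 the density may
vanish and the rate may fail, but there the sample extremes are at least as good as the endpoints of
the support, and only an upper bound is needed. The optimal sample cost is compared with the optimal
\<open>\<mu>\<close>-cost through the mean deviation of the empirical distribution function on a grid of mesh \<open>1/n\<close>.
\<close>

section \<open>Facility cost and the first Wasserstein distance\<close>

text \<open>For \<open>k = 0\<close> this is \<open>Min\<close> of the empty set, about which
  nothing is known; hence the recurring hypothesis \<open>k \<ge> 1\<close>.\<close>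

definition dmin :: "nat \<Rightarrow> (nat \<Rightarrow> real) \<Rightarrow> real \<Rightarrow> real" where
  "dmin k p x = Min ((\<lambda>j. \<bar>x - p j\<bar>) ` {1..k})"

definition cost :: "real measure \<Rightarrow> nat \<Rightarrow> (nat \<Rightarrow> real) \<Rightarrow> real" where
  "cost M k p = (\<integral>x. dmin k p x \<partial>M)"

lemma SC_eq_dmin: "SC n k x p = (\<Sum>i<n. dmin k p (x i)) / real n"
  by (simp add: SC_def dmin_def)

lemma dmin_le: "j \<in> {1..k} \<Longrightarrow> dmin k p x \<le> \<bar>x - p j\<bar>"
  unfolding dmin_def by (intro Min_le) auto

lemma dmin_attained:
  assumes "k \<ge> 1"
  obtains j where "j \<in> {1..k}" "dmin k p x = \<bar>x - p j\<bar>"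
proof -
  have "dmin k p x \<in> (\<lambda>j. \<bar>x - p j\<bar>) ` {1..k}"
    unfolding dmin_def using assms by (intro Min_in) auto
  then show ?thesis using that by auto
qed

lemma dmin_nonneg: "k \<ge> 1 \<Longrightarrow> 0 \<le> dmin k p x"
  by (rule dmin_attained[of k p x]) auto

text \<open>Compare through the index that is nearest in the right-hand configuration. The common
  slack \<open>w\<close> lets one lemma serve both for moving the agent and for moving the
  facilities.\<close>

lemma dmin_mono:
  assumes "k \<ge> 1" "\<And>j. j \<in> {1..k} \<Longrightarrow> \<bar>x - p j\<bar> \<le> \<bar>x' - r j\<bar> + w"
  shows "dmin k p x \<le> dmin k r x' + w"
proof -
  obtain j where j: "j \<in> {1..k}" "dmin k r x' = \<bar>x' - r j\<bar>" using dmin_attained[OF assms(1)] .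
  show ?thesis using dmin_le[OF j(1), of p x] assms(2)[OF j(1)] j(2) by linarith
qed

lemma dmin_lipschitz: "k \<ge> 1 \<Longrightarrow> \<bar>dmin k p x - dmin k p x'\<bar> \<le> \<bar>x - x'\<bar>"
proof -
  assume "k \<ge> 1"
  then have "dmin k p x \<le> dmin k p x' + \<bar>x - x'\<bar>" "dmin k p x' \<le> dmin k p x + \<bar>x - x'\<bar>"
    by (auto intro!: dmin_mono)
  then show ?thesis by linarith
qed

lemma borel_measurable_dmin [measurable]: "dmin k p \<in> borel_measurable borel"
  unfolding dmin_def[abs_def] by (intro borel_measurable_Min) auto

lemma (in finite_measure) integrable_indicat_sets:
  "A \<in> sets M \<Longrightarrow> integrable M (indicat_real A)"
  by (rule integrable_real_indicator) (auto simp: emeasure_eq_measure)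

text \<open>The bounds are almost sure rather than a statement on \<open>spt M\<close>, so the same
  law can be viewed on several intervals: one shared by two measures, a larger one that also
  contains stray facilities, or its own support.\<close>

locale bounded_distribution = real_distribution M for M :: "real measure" +
  fixes a b :: real
  assumes AE_bounds: "AE x in M. a \<le> x \<and> x \<le> b"
begin

lemma integrable_dmin: "k \<ge> 1 \<Longrightarrow> integrable M (dmin k p)"
proof (rule integrable_const_bound[where B = "dmin k p a + (b - a)"])
  assume k: "k \<ge> 1"
  show "AE x in M. norm (dmin k p x) \<le> dmin k p a + (b - a)"
    using AE_bounds
  proof eventually_elim
    case (elim x)
    then show ?case
      using dmin_lipschitz[OF k, of p x a] dmin_nonneg[OF k, of p x] by auto
  qed
qed simp

lemma cost_nonneg: "k \<ge> 1 \<Longrightarrow> 0 \<le> cost M k p"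
  unfolding cost_def by (intro integral_nonneg_AE) (simp add: dmin_nonneg)

lemma nn_integral_dmin:
  "k \<ge> 1 \<Longrightarrow> (\<integral>\<^sup>+x. ennreal (dmin k p x) \<partial>M) = ennreal (cost M k p)"
  unfolding cost_def using integrable_dmin dmin_nonneg by (intro nn_integral_eq_integral) auto

lemma cost_le:
  assumes "k \<ge> 1" "AE x in M. dmin k p x \<le> dmin k r x + w"
  shows "cost M k p \<le> cost M k r + w"
proof -
  have "cost M k p \<le> (\<integral>x. dmin k r x + w \<partial>M)"
    unfolding cost_def using assms(2) integrable_dmin[OF assms(1)] by (intro integral_mono_AE) auto
  also have "\<dots> = cost M k r + w"
    using integrable_dmin[OF assms(1)] prob_space by (simp add: cost_def)
  finally show ?thesis .
qed

end

section \<open>Couplings and the transport cost \<open>W1\<close>\<close>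

lemma couplingsD:
  assumes "\<pi> \<in> couplings \<alpha> \<beta>" "sets \<alpha> = sets borel" "sets \<beta> = sets borel"
  shows "sets \<pi> = sets borel" "prob_space \<pi>"
    "\<And>f. f \<in> borel_measurable borel \<Longrightarrow> (\<integral>\<^sup>+z. f (fst z) \<partial>\<pi>) = (\<integral>\<^sup>+x. f x \<partial>\<alpha>)"
    "\<And>f. f \<in> borel_measurable borel \<Longrightarrow> (\<integral>\<^sup>+z. f (snd z) \<partial>\<pi>) = (\<integral>\<^sup>+x. f x \<partial>\<beta>)"
    "\<And>P. AE x in \<alpha>. P x \<Longrightarrow> AE z in \<pi>. P (fst z)"
    "\<And>P. AE x in \<beta>. P x \<Longrightarrow> AE z in \<pi>. P (snd z)"
    "fst \<in> measurable \<pi> borel" "snd \<in> measurable \<pi> borel"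
proof -
  have s: "sets \<pi> = sets (borel \<Otimes>\<^sub>M borel)" and d: "distr \<pi> borel fst = \<alpha>" "distr \<pi> borel snd = \<beta>"
    and "prob_space \<pi>"
    using assms(1) by (auto simp: couplings_def)
  show "sets \<pi> = sets borel" using s borel_prod[where ?'a=real and ?'b=real] by metis
  show m: "fst \<in> measurable \<pi> borel" "snd \<in> measurable \<pi> borel"
    using measurable_cong_sets[OF s refl] by auto
  show "prob_space \<pi>" by fact
  show "(\<integral>\<^sup>+z. f (fst z) \<partial>\<pi>) = (\<integral>\<^sup>+x. f x \<partial>\<alpha>)" if "f \<in> borel_measurable borel" for f
    unfolding d(1)[symmetric] using that m by (intro nn_integral_distr[symmetric]) auto
  show "(\<integral>\<^sup>+z. f (snd z) \<partial>\<pi>) = (\<integral>\<^sup>+x. f x \<partial>\<beta>)" if "f \<in> borel_measurable borel" for f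
    unfolding d(2)[symmetric] using that m by (intro nn_integral_distr[symmetric]) auto
  show "AE z in \<pi>. P (fst z)" if "AE x in \<alpha>. P x" for P
    using that unfolding d(1)[symmetric] by (rule AE_distrD[OF m(1)])
  show "AE z in \<pi>. P (snd z)" if "AE x in \<beta>. P x" for P
    using that unfolding d(2)[symmetric] by (rule AE_distrD[OF m(2)])
qed

text \<open>The independent coupling serves to bound the infima over couplings from above; over an
  empty set they would be infinite.\<close>

lemma pair_measure_in_couplings:
  assumes "real_distribution \<alpha>" "real_distribution \<beta>"
  shows "\<alpha> \<Otimes>\<^sub>M \<beta> \<in> couplings \<alpha> \<beta>"
proof -
  interpret A: real_distribution \<alpha> by fact
  interpret B: real_distribution \<beta> by fact
  interpret P: pair_prob_space \<alpha> \<beta> by unfold_locales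
  have "distr (\<alpha> \<Otimes>\<^sub>M \<beta>) borel fst = distr (\<alpha> \<Otimes>\<^sub>M \<beta>) \<alpha> fst"
    by (rule distr_cong) auto
  also have "\<dots> = \<alpha>" by (rule B.distr_pair_fst)
  finally have 1: "distr (\<alpha> \<Otimes>\<^sub>M \<beta>) borel fst = \<alpha>" .
  have "distr (\<alpha> \<Otimes>\<^sub>M \<beta>) borel snd = \<beta>"
  proof (rule measure_eqI)
    fix A assume A: "A \<in> sets (distr (\<alpha> \<Otimes>\<^sub>M \<beta>) borel snd)"
    then have "emeasure (distr (\<alpha> \<Otimes>\<^sub>M \<beta>) borel snd) A = emeasure (\<alpha> \<Otimes>\<^sub>M \<beta>) (snd -` A \<inter> space (\<alpha> \<Otimes>\<^sub>M \<beta>))"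
      by (subst emeasure_distr) auto
    also have "snd -` A \<inter> space (\<alpha> \<Otimes>\<^sub>M \<beta>) = space \<alpha> \<times> A"
      by (auto simp: space_pair_measure)
    finally show "emeasure (distr (\<alpha> \<Otimes>\<^sub>M \<beta>) borel snd) A = emeasure \<beta> A"
      using A using B.emeasure_pair_measure_Times[of "space \<alpha>" \<alpha> A] A.emeasure_space_1 by simp
  qed simp
  with 1 show ?thesis
    using P.prob_space_axioms by (simp add: couplings_def cong: sets_pair_measure_cong)
qed

lemma AE_coupling_bound:
  assumes "bounded_distribution \<alpha> a b" "bounded_distribution \<beta> a b" "\<pi> \<in> couplings \<alpha> \<beta>"
  shows "AE z in \<pi>. \<bar>fst z - snd z\<bar> \<le> b - a"
proof -
  interpret A: bounded_distribution \<alpha> a b by fact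
  interpret B: bounded_distribution \<beta> a b by fact
  note c = couplingsD[OF assms(3) A.events_eq_borel B.events_eq_borel]
  show ?thesis using c(5)[OF A.AE_bounds] c(6)[OF B.AE_bounds] by eventually_elim auto
qed

lemma nn_integral_le_const:
  assumes "prob_space M" "AE x in M. f x \<le> c"
  shows "(\<integral>\<^sup>+x. f x \<partial>M) \<le> c"
proof -
  have "(\<integral>\<^sup>+x. f x \<partial>M) \<le> (\<integral>\<^sup>+x. c \<partial>M)" using assms(2) by (intro nn_integral_mono_AE)
  also have "\<dots> = c" using assms(1) by (simp add: prob_space.emeasure_space_1)
  finally show ?thesis .
qed

text \<open>\<open>enn2real\<close> sends infinity to 0, so \<open>W1\<close> is the infimum only
  once that infimum is known to be finite; the independent coupling bounds it by
  \<open>b - a\<close>.\<close>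

lemma W1_eq:
  assumes "bounded_distribution \<alpha> a b" "bounded_distribution \<beta> a b"
  shows "ennreal (W1 \<alpha> \<beta>) = (INF \<pi>\<in>couplings \<alpha> \<beta>. \<integral>\<^sup>+ z. ennreal \<bar>fst z - snd z\<bar> \<partial>\<pi>)"
proof -
  let ?\<pi> = "\<alpha> \<Otimes>\<^sub>M \<beta>"
  have p: "?\<pi> \<in> couplings \<alpha> \<beta>"
    using assms by (intro pair_measure_in_couplings) (auto simp: bounded_distribution_def)
  have "(INF \<pi>\<in>couplings \<alpha> \<beta>. \<integral>\<^sup>+ z. ennreal \<bar>fst z - snd z\<bar> \<partial>\<pi>) \<le> (\<integral>\<^sup>+ z. ennreal \<bar>fst z - snd z\<bar> \<partial>?\<pi>)"
    by (rule INF_lower[OF p])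
  also have "\<dots> \<le> ennreal (b - a)"
    using AE_coupling_bound[OF assms p] p
    by (intro nn_integral_le_const) (auto simp: couplings_def intro: ennreal_leI)
  also have "\<dots> < top" by simp
  finally show ?thesis
    unfolding W1_def by (rule ennreal_enn2real)
qed

lemma W1_nonneg: "0 \<le> W1 \<alpha> \<beta>"
  by (simp add: W1_def)

text \<open>A negative \<open>c\<close> is harmless: \<open>ennreal\<close> truncates it to 0, and
  \<open>W1\<close> is nonnegative.\<close>

lemma W1_lowerI:
  assumes "bounded_distribution \<alpha> a b" "bounded_distribution \<beta> a b"
    and "\<And>\<pi>. \<pi> \<in> couplings \<alpha> \<beta> \<Longrightarrow> ennreal c \<le> (\<integral>\<^sup>+ z. ennreal \<bar>fst z - snd z\<bar> \<partial>\<pi>)"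
  shows "c \<le> W1 \<alpha> \<beta>"
proof -
  have "ennreal c \<le> ennreal (W1 \<alpha> \<beta>)"
    unfolding W1_eq[OF assms(1,2)] using assms(3) by (intro INF_greatest)
  then show ?thesis by (subst (asm) ennreal_le_iff) (simp_all add: W1_nonneg)
qed

lemma W1_upperI:
  assumes "bounded_distribution \<alpha> a b" "bounded_distribution \<beta> a b" "\<pi> \<in> couplings \<alpha> \<beta>" "0 \<le> c"
    and "(\<integral>\<^sup>+ z. ennreal \<bar>fst z - snd z\<bar> \<partial>\<pi>) \<le> ennreal c"
  shows "W1 \<alpha> \<beta> \<le> c"
proof -
  have "ennreal (W1 \<alpha> \<beta>) \<le> (\<integral>\<^sup>+ z. ennreal \<bar>fst z - snd z\<bar> \<partial>\<pi>)"
    unfolding W1_eq[OF assms(1,2)] using assms(3) by (intro INF_lower)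
  also note assms(5)
  finally show ?thesis using assms(4) by simp
qed

text \<open>Swapping the coordinates turns a coupling for one order into one for the other at the
  same cost; one inequality for all pairs then gives both.\<close>

lemma W1_commute: "W1 \<alpha> \<beta> = W1 \<beta> \<alpha>"
proof -
  let ?c = "\<lambda>\<pi>. \<integral>\<^sup>+ z. ennreal \<bar>fst z - snd z\<bar> \<partial>\<pi>"
  have le: "(INF \<pi>\<in>couplings \<alpha> \<beta>. ?c \<pi>) \<le> (INF \<pi>\<in>couplings \<beta> \<alpha>. ?c \<pi>)" for \<alpha> \<beta>
  proof (rule INF_greatest)
    fix \<pi> assume \<pi>: "\<pi> \<in> couplings \<beta> \<alpha>"
    then have s [measurable_cong]: "sets \<pi> = sets (borel \<Otimes>\<^sub>M borel)" and p: "prob_space \<pi>"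
      by (auto simp: couplings_def)
    let ?s = "\<lambda>z::real \<times> real. (snd z, fst z)"
    let ?d = "distr \<pi> (borel \<Otimes>\<^sub>M borel) ?s"
    have "?d \<in> couplings \<alpha> \<beta>"
      using \<pi> p by (auto simp: couplings_def distr_distr comp_def intro!: prob_space.prob_space_distr)
    then have "(INF \<pi>\<in>couplings \<alpha> \<beta>. ?c \<pi>) \<le> ?c ?d"
      by (rule INF_lower)
    also have "\<dots> = ?c \<pi>"
      by (subst nn_integral_distr) (auto simp: abs_minus_commute)
    finally show "(INF \<pi>\<in>couplings \<alpha> \<beta>. ?c \<pi>) \<le> ?c \<pi>" .
  qed
  show ?thesis unfolding W1_def antisym[OF le[of \<alpha> \<beta>] le[of \<beta> \<alpha>]] ..
qed

text \<open>Integrate the Lipschitz bound for \<open>dmin\<close> against an arbitrary coupling and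
  take the infimum: the easy half of Kantorovich duality.\<close>

lemma cost_le_cost_plus_W1:
  assumes "bounded_distribution \<alpha> a b" "bounded_distribution \<beta> a b" "k \<ge> 1"
  shows "cost \<alpha> k p \<le> cost \<beta> k p + W1 \<alpha> \<beta>"
proof -
  interpret A: bounded_distribution \<alpha> a b by fact
  interpret B: bounded_distribution \<beta> a b by fact
  have "cost \<alpha> k p - cost \<beta> k p \<le> W1 \<alpha> \<beta>"
  proof (rule W1_lowerI[OF assms(1,2)])
    fix \<pi> assume \<pi>: "\<pi> \<in> couplings \<alpha> \<beta>"
    note c = couplingsD[OF \<pi> A.events_eq_borel B.events_eq_borel]
    note [measurable] = c(7,8)
    have "ennreal (cost \<alpha> k p) = (\<integral>\<^sup>+z. ennreal (dmin k p (fst z)) \<partial>\<pi>)"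
      using c(3)[of "\<lambda>x. ennreal (dmin k p x)"] by (simp add: A.nn_integral_dmin[OF assms(3)])
    also have "\<dots> \<le> (\<integral>\<^sup>+z. ennreal (dmin k p (snd z)) + ennreal \<bar>fst z - snd z\<bar> \<partial>\<pi>)"
    proof (rule nn_integral_mono)
      fix z :: "real \<times> real"
      have "dmin k p (fst z) \<le> dmin k p (snd z) + \<bar>fst z - snd z\<bar>"
        using dmin_lipschitz[OF assms(3), of p "fst z" "snd z"] by linarith
      then show "ennreal (dmin k p (fst z)) \<le> ennreal (dmin k p (snd z)) + ennreal \<bar>fst z - snd z\<bar>"
        using assms(3) by (subst ennreal_plus[symmetric]) (auto intro: ennreal_leI dmin_nonneg)
    qed
    also have "\<dots> = (\<integral>\<^sup>+z. ennreal (dmin k p (snd z)) \<partial>\<pi>) + (\<integral>\<^sup>+z. ennreal \<bar>fst z - snd z\<bar> \<partial>\<pi>)"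
      by (intro nn_integral_add) auto
    also have "(\<integral>\<^sup>+z. ennreal (dmin k p (snd z)) \<partial>\<pi>) = ennreal (cost \<beta> k p)"
      using c(4)[of "\<lambda>x. ennreal (dmin k p x)"] by (simp add: B.nn_integral_dmin[OF assms(3)])
    finally have "ennreal (cost \<alpha> k p) - ennreal (cost \<beta> k p) \<le> (\<integral>\<^sup>+z. ennreal \<bar>fst z - snd z\<bar> \<partial>\<pi>)"
      by (simp add: ennreal_minus_le_iff)
    then show "ennreal (cost \<alpha> k p - cost \<beta> k p) \<le> (\<integral>\<^sup>+z. ennreal \<bar>fst z - snd z\<bar> \<partial>\<pi>)"
      using assms(3) by (simp add: ennreal_minus B.cost_nonneg)
  qed
  then show ?thesis by simp
qed

section \<open>Nearest-point assignment and approximation by \<open>k\<close> atoms\<close>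

text \<open>An explicit selection of a nearest facility, ties going to the smaller index, so that
  measurability follows by induction. The base value \<open>p 1\<close> is compared with itself in
  the first step.\<close>

fun nearest :: "(nat \<Rightarrow> real) \<Rightarrow> nat \<Rightarrow> real \<Rightarrow> real" where
  "nearest p 0 x = p 1"
| "nearest p (Suc j) x = (if \<bar>x - p (Suc j)\<bar> < \<bar>x - nearest p j x\<bar> then p (Suc j) else nearest p j x)"

lemma borel_measurable_nearest [measurable]: "nearest p j \<in> borel_measurable borel"
proof (induction j)
  case (Suc j)
  note [measurable] = Suc
  show ?case unfolding nearest.simps(2)[abs_def] by measurable
qed (simp add: nearest.simps(1)[abs_def])

lemma nearest_props:
  "k \<ge> 1 \<Longrightarrow> nearest p k x \<in> p ` {1..k} \<and> (\<forall>j\<in>{1..k}. \<bar>x - nearest p k x\<bar> \<le> \<bar>x - p j\<bar>)"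
proof (induction k)
  case (Suc k)
  show ?case
  proof (cases "k = 0")
    case False
    with Suc.IH have IH: "nearest p k x \<in> p ` {1..k}" "\<And>j. j \<in> {1..k} \<Longrightarrow> \<bar>x - nearest p k x\<bar> \<le> \<bar>x - p j\<bar>"
      by auto
    have e: "{1..Suc k} = insert (Suc k) {1..k}" by auto
    show ?thesis
    proof (cases "\<bar>x - p (Suc k)\<bar> < \<bar>x - nearest p k x\<bar>")
      case True
      then show ?thesis using IH(2) unfolding e by fastforce
    next
      case False
      then have n: "nearest p (Suc k) x = nearest p k x" by simp
      show ?thesis using IH False unfolding e n by auto
    qed
  qed simp
qed simp

lemma dist_nearest: "k \<ge> 1 \<Longrightarrow> \<bar>x - nearest p k x\<bar> = dmin k p x"
proof (rule antisym)
  assume k: "k \<ge> 1"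
  obtain j where "j \<in> {1..k}" "dmin k p x = \<bar>x - p j\<bar>" using dmin_attained[OF k] .
  then show "\<bar>x - nearest p k x\<bar> \<le> dmin k p x" using nearest_props[OF k, of p x] by simp
  show "dmin k p x \<le> \<bar>x - nearest p k x\<bar>" using nearest_props[OF k, of p x] dmin_le by auto
qed

lemma bounded_distribution_weaken:
  assumes "bounded_distribution M a b" "a' \<le> a" "b \<le> b'"
  shows "bounded_distribution M a' b'"
proof -
  interpret bounded_distribution M a b by fact
  show ?thesis
    by unfold_locales (rule eventually_mono[OF AE_bounds], use assms(2,3) in auto)
qed

lemma finite_support_bounds:
  assumes "finite S" "prob_space l" "sets l = sets borel" "AE x in l. x \<in> S"
  obtains c d :: real where "bounded_distribution l c d"
proof
  have "real_distribution l" using assms by (auto simp: real_distribution_def real_distribution_axioms_def)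
  moreover have "AE x in l. Min S \<le> x \<and> x \<le> Max S"
    using assms(4) by eventually_elim (use assms(1) in auto)
  ultimately show "bounded_distribution l (Min S) (Max S)"
    by (simp add: bounded_distribution_def bounded_distribution_axioms_def)
qed

text \<open>Upper bound: the image of \<open>M\<close> under \<open>nearest p k\<close> has at most
  \<open>k\<close> atoms and is reached at transport cost \<open>cost M k p\<close>. Lower bound: a
  coupling with \<open>\<nu>\<close> sends almost every point to some \<open>y j\<close>, which is
  no closer than the nearest one.\<close>

lemma (in bounded_distribution) W1_opt_k_cost:
  assumes k: "k \<ge> 1" and opt: "W1_opt_k k M \<nu>" and sp: "support_points k \<nu> y"
  shows "W1 M \<nu> = cost M k y" "cost M k y \<le> cost M k p"
proof -
  have W1_le: "W1 M \<nu> \<le> cost M k p" for p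
  proof -
    let ?l = "distr M borel (nearest p k)"
    have l: "prob_space ?l" by (rule prob_space_distr) simp
    have AEl: "AE x in ?l. x \<in> p ` {1..k}"
      by (subst AE_distr_iff) (use nearest_props[OF k] in \<open>auto intro!: finite_imp_closed borel_closed\<close>)
    then have "emeasure ?l (p ` {1..k}) = 1"
      by (intro prob_space.emeasure_eq_1_AE[OF l]) (auto intro!: finite_imp_closed borel_closed)
    moreover have "card (p ` {1..k}) \<le> k" by (rule order_trans[OF card_image_le]) auto
    ultimately have Pk: "?l \<in> Pk k"
      using l unfolding Pk_def by (auto intro!: exI[of _ "p ` {1..k}"])
    obtain c d where "bounded_distribution ?l c d"
      by (rule finite_support_bounds[OF _ l _ AEl]) auto
    \<comment> \<open>The facilities may lie outside [a, b], so both laws are put on a common larger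
      interval.\<close>
    then have bd: "bounded_distribution ?l (min a c) (max b d)" "bounded_distribution M (min a c) (max b d)"
      using bounded_distribution_axioms by (auto intro: bounded_distribution_weaken)
    let ?\<pi> = "distr M (borel \<Otimes>\<^sub>M borel) (\<lambda>x. (x, nearest p k x))"
    have \<pi>: "?\<pi> \<in> couplings M ?l"
    proof -
      have "distr M borel (\<lambda>x. x) = M"
        by (rule distr_id2) simp
      then show ?thesis
        by (auto simp: couplings_def distr_distr comp_def intro!: prob_space_distr)
    qed
    have "(\<integral>\<^sup>+ z. ennreal \<bar>fst z - snd z\<bar> \<partial>?\<pi>) = ennreal (cost M k p)"
      by (subst nn_integral_distr) (auto simp: dist_nearest[OF k] nn_integral_dmin[OF k])
    then have "W1 M ?l \<le> cost M k p"
      using W1_upperI[OF bd(2,1) \<pi>] cost_nonneg[OF k] by simp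
    then show ?thesis using opt Pk unfolding W1_opt_k_def by force
  qed
  have "cost M k y \<le> W1 M \<nu>"
  proof -
    have n: "prob_space \<nu>" "sets \<nu> = sets borel" using opt by (auto simp: W1_opt_k_def Pk_def)
    have AEn: "AE x in \<nu>. x \<in> y ` {1..k}"
      using sp n by (intro prob_space.AE_prob_1) (auto simp: support_points_def measure_def)
    obtain c d where "bounded_distribution \<nu> c d"
      by (rule finite_support_bounds[OF _ n AEn]) auto
    then have bd: "bounded_distribution \<nu> (min a c) (max b d)" "bounded_distribution M (min a c) (max b d)"
      using bounded_distribution_axioms by (auto intro: bounded_distribution_weaken)
    show ?thesis
    proof (rule W1_lowerI[OF bd(2,1)])
      fix \<pi> assume \<pi>: "\<pi> \<in> couplings M \<nu>"
      note c = couplingsD[OF \<pi> events_eq_borel n(2)]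
      note [measurable] = c(7,8)
      have "ennreal (cost M k y) = (\<integral>\<^sup>+z. ennreal (dmin k y (fst z)) \<partial>\<pi>)"
        using c(3)[of "\<lambda>x. ennreal (dmin k y x)"] by (simp add: nn_integral_dmin[OF k])
      also have "\<dots> \<le> (\<integral>\<^sup>+z. ennreal \<bar>fst z - snd z\<bar> \<partial>\<pi>)"
      proof (rule nn_integral_mono_AE)
        show "AE z in \<pi>. ennreal (dmin k y (fst z)) \<le> ennreal \<bar>fst z - snd z\<bar>"
          using c(6)[OF AEn] by eventually_elim (auto intro!: ennreal_leI dmin_le)
      qed
      finally show "ennreal (cost M k y) \<le> (\<integral>\<^sup>+z. ennreal \<bar>fst z - snd z\<bar> \<partial>\<pi>)" .
    qed
  qed
  with W1_le show "W1 M \<nu> = cost M k y" "cost M k y \<le> cost M k p"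
    by (auto intro: antisym order_trans)
qed

section \<open>The supremal Wasserstein distance and gaps of the distribution\<close>

text \<open>The complement of the support is a union of null open sets; second countability reduces
  it to a countable union.\<close>

lemma AE_in_spt:
  fixes M :: "'a::second_countable_topology measure"
  assumes "sets M = sets borel"
  shows "AE z in M. z \<in> spt M"
proof -
  let ?F = "{U. open U \<and> emeasure M U = 0}"
  obtain F' where F': "F' \<subseteq> ?F" "countable F'" "\<Union>F' = \<Union>?F"
    using Lindelof[of ?F] by auto
  have "\<Union>F' \<in> null_sets M"
  proof -
    have "U \<in> null_sets M" if "U \<in> F'" for U
      using that F'(1) assms by (auto simp: null_sets_def)
    then show ?thesis using null_sets_UN'[OF F'(2), of "\<lambda>U. U" M] by simp
  qed
  moreover have "{z \<in> space M. z \<notin> spt M} \<subseteq> \<Union>F'"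
    unfolding F'(3) by (auto simp: spt_def zero_less_iff_neq_zero)
  ultimately show ?thesis by (rule AE_I')
qed

lemma spt_subset_closed:
  assumes "sets M = sets borel" "closed C" "AE z in M. z \<in> C"
  shows "spt M \<subseteq> C"
proof
  fix z assume z: "z \<in> spt M"
  have "emeasure M {z \<in> space M. z \<notin> C} = 0"
    by (rule emeasure_eq_0_AE) (use assms(3) in simp)
  also have "{z \<in> space M. z \<notin> C} = - C"
    using sets_eq_imp_space_eq[OF assms(1)] by auto
  finally show "z \<in> C" using z assms(2) unfolding spt_def
    by (metis (mono_tags, lifting) ComplI mem_Collect_eq not_less_zero open_Compl zero_less_iff_neq_zero)
qed

text \<open>The slack \<open>e\<close> avoids showing that the infimum defining \<open>Winf\<close>
  is attained. The almost sure bound frees the later arguments from supports of couplings.\<close>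

lemma Winf_coupling:
  assumes "bounded_distribution \<alpha> a b" "bounded_distribution \<beta> a b" "e > 0"
  obtains \<pi> where "\<pi> \<in> couplings \<alpha> \<beta>" "AE z in \<pi>. \<bar>fst z - snd z\<bar> \<le> Winf \<alpha> \<beta> + e" "0 \<le> Winf \<alpha> \<beta>"
proof -
  interpret A: bounded_distribution \<alpha> a b by fact
  interpret B: bounded_distribution \<beta> a b by fact
  define S where "S = (\<lambda>\<pi>::(real\<times>real) measure. SUP z\<in>spt \<pi>. ereal \<bar>fst z - snd z\<bar>)"
  define I where "I = (INF \<pi>\<in>couplings \<alpha> \<beta>. S \<pi>)"
  have W: "Winf \<alpha> \<beta> = real_of_ereal I" by (simp add: Winf_def I_def S_def)
  have spt_AE: "AE z in \<pi>. z \<in> spt \<pi>" if "\<pi> \<in> couplings \<alpha> \<beta>" for \<pi>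
    using couplingsD(1)[OF that] by (intro AE_in_spt) auto
  have nonneg: "0 \<le> S \<pi>" if \<pi>: "\<pi> \<in> couplings \<alpha> \<beta>" for \<pi>
  proof -
    interpret prob_space \<pi> using \<pi> by (simp add: couplings_def)
    have "spt \<pi> \<noteq> {}" using spt_AE[OF \<pi>] by auto
    then obtain z where "z \<in> spt \<pi>" by auto
    then have "ereal \<bar>fst z - snd z\<bar> \<le> S \<pi>" unfolding S_def by (rule SUP_upper)
    then show ?thesis by (rule order_trans[rotated]) simp
  qed
  have "0 \<le> I" unfolding I_def using nonneg by (rule INF_greatest)
  have p: "\<alpha> \<Otimes>\<^sub>M \<beta> \<in> couplings \<alpha> \<beta>"
    by (intro pair_measure_in_couplings) unfold_locales
  \<comment> \<open>A finite upper bound on the infimum is needed because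
    \<open>real_of_ereal\<close> maps infinity to 0.\<close>
  have "spt (\<alpha> \<Otimes>\<^sub>M \<beta>) \<subseteq> {z. \<bar>fst z - snd z\<bar> \<le> b - a}"
    using couplingsD(1)[OF p] AE_coupling_bound[OF assms(1,2) p]
    by (intro spt_subset_closed) (auto intro!: closed_Collect_le continuous_intros)
  then have "S (\<alpha> \<Otimes>\<^sub>M \<beta>) \<le> ereal (b - a)"
    unfolding S_def by (intro SUP_least) auto
  then have "I \<le> ereal (b - a)" unfolding I_def by (rule INF_lower2[OF p])
  with \<open>0 \<le> I\<close> have I: "I = ereal (Winf \<alpha> \<beta>)" unfolding W
    by (cases I) auto
  then have "I < ereal (Winf \<alpha> \<beta> + e)" using \<open>e > 0\<close> by simp
  then obtain \<pi> where \<pi>: "\<pi> \<in> couplings \<alpha> \<beta>" "S \<pi> < ereal (Winf \<alpha> \<beta> + e)"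
    unfolding I_def by (auto simp: INF_less_iff)
  have "AE z in \<pi>. \<bar>fst z - snd z\<bar> \<le> Winf \<alpha> \<beta> + e"
    using spt_AE[OF \<pi>(1)]
  proof eventually_elim
    case (elim z)
    then have "ereal \<bar>fst z - snd z\<bar> \<le> S \<pi>" unfolding S_def by (rule SUP_upper)
    also note \<pi>(2)
    finally show ?case by simp
  qed
  with that \<pi>(1) \<open>0 \<le> I\<close> I show ?thesis by auto
qed

text \<open>A nearly optimal coupling for \<open>Winf\<close> also competes in the infimum defining
  \<open>W1\<close>, and an average is at most an essential bound.\<close>

lemma W1_le_Winf:
  assumes "bounded_distribution \<alpha> a b" "bounded_distribution \<beta> a b"
  shows "W1 \<alpha> \<beta> \<le> Winf \<alpha> \<beta>"
proof (rule field_le_epsilon)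
  fix e :: real assume "e > 0"
  obtain \<pi> where \<pi>: "\<pi> \<in> couplings \<alpha> \<beta>" "AE z in \<pi>. \<bar>fst z - snd z\<bar> \<le> Winf \<alpha> \<beta> + e" "0 \<le> Winf \<alpha> \<beta>"
    by (rule Winf_coupling[OF assms \<open>e > 0\<close>])
  show "W1 \<alpha> \<beta> \<le> Winf \<alpha> \<beta> + e"
  proof (intro W1_upperI[OF assms \<pi>(1)] nn_integral_le_const)
    show "AE z in \<pi>. ennreal \<bar>fst z - snd z\<bar> \<le> ennreal (Winf \<alpha> \<beta> + e)"
      using \<pi>(2) by eventually_elim (rule ennreal_leI)
  qed (use \<pi> \<open>e > 0\<close> in \<open>auto simp: couplings_def\<close>)
qed

text \<open>Almost surely under \<pi>, one coordinate being at most \<open>t\<close> forces the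
  other to be at most \<open>t + w\<close>.\<close>

lemma cdf_coupling_shift:
  assumes "real_distribution \<alpha>" "real_distribution \<beta>" "\<pi> \<in> couplings \<alpha> \<beta>"
    and AE: "AE z in \<pi>. \<bar>fst z - snd z\<bar> \<le> w"
  shows "cdf \<alpha> t \<le> cdf \<beta> (t + w)" "cdf \<beta> t \<le> cdf \<alpha> (t + w)"
proof -
  interpret A: real_distribution \<alpha> by fact
  interpret B: real_distribution \<beta> by fact
  note c = couplingsD[OF assms(3) A.events_eq_borel B.events_eq_borel]
  have a: "(\<integral>\<^sup>+z. indicator {..t} (fst z) \<partial>\<pi>) = emeasure \<alpha> {..t}" for t
    using c(3)[of "indicator {..t}"] by simp
  have b: "(\<integral>\<^sup>+z. indicator {..t} (snd z) \<partial>\<pi>) = emeasure \<beta> {..t}" for t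
    using c(4)[of "indicator {..t}"] by simp
  have "(\<integral>\<^sup>+z. indicator {..t} (fst z) \<partial>\<pi>) \<le> (\<integral>\<^sup>+z. indicator {..t + w} (snd z) \<partial>\<pi>)"
    using AE by (intro nn_integral_mono_AE) (auto split: split_indicator)
  then show "cdf \<alpha> t \<le> cdf \<beta> (t + w)"
    unfolding a b cdf_def by (simp add: A.emeasure_eq_measure B.emeasure_eq_measure)
  have "(\<integral>\<^sup>+z. indicator {..t} (snd z) \<partial>\<pi>) \<le> (\<integral>\<^sup>+z. indicator {..t + w} (fst z) \<partial>\<pi>)"
    using AE by (intro nn_integral_mono_AE) (auto split: split_indicator)
  then show "cdf \<beta> t \<le> cdf \<alpha> (t + w)"
    unfolding a b cdf_def by (simp add: A.emeasure_eq_measure B.emeasure_eq_measure)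
qed

section \<open>Moving the facilities of an optimal configuration across null gaps\<close>

context bounded_distribution
begin

text \<open>Since moving \<open>p j\<close> to the right cannot help, at least half of the mass of
  its cell lies at or left of it. Moving it left across a null gap then brings it closer to at least
  as much mass as it moves away from. If no mass lies at or left of \<open>p j\<close>, the same
  inequality makes the whole cell null.\<close>

lemma cost_shift_one:
  assumes k: "k \<ge> 1" and j: "j \<in> {1..k}" and opt: "\<And>r. cost M k p \<le> cost M k r"
    and t: "cdf M (p j) = 0 \<or> (t \<le> p j \<and> cdf M t = cdf M (p j))"
  shows "cost M k (p(j := t)) \<le> cost M k p"
proof -
  define s where "s = p j"
  \<comment> \<open>The cell of \<open>p j\<close>, ties included. At a tie \<open>h\<close> may
    overstate the change of \<open>dmin\<close>, but only an upper bound is used.\<close>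
  define A where "A = {x. \<forall>i\<in>{1..k}. \<bar>x - s\<bar> \<le> \<bar>x - p i\<bar>}"
  define h :: "real \<Rightarrow> real \<Rightarrow> real" where "h u x = indicator A x * (\<bar>x - u\<bar> - \<bar>x - s\<bar>)" for u x
  have [measurable]: "A \<in> sets borel" unfolding A_def by measurable
  have h_meas [measurable]: "h u \<in> borel_measurable borel" for u
    unfolding h_def[abs_def] by measurable
  have int_h: "integrable M (h u)" for u
    by (rule integrable_const_bound[where B = "\<bar>u - s\<bar>"]) (auto simp: h_def split: split_indicator)
  \<comment> \<open>Only points whose nearest facility is \<open>p j\<close> are affected when it moves to \<open>u\<close>.\<close>
  have key: "dmin k (p(j := u)) x \<le> dmin k p x + h u x" for u x
  proof (cases "x \<in> A")
    case True
    obtain i where i: "i \<in> {1..k}" "dmin k p x = \<bar>x - p i\<bar>" using dmin_attained[OF k] .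
    have "\<bar>x - s\<bar> \<le> \<bar>x - p i\<bar>" using True i(1) by (simp add: A_def)
    then show ?thesis
      using i(2) True dmin_le[OF j, of "p(j := u)" x] by (simp add: h_def)
  next
    case False
    obtain i where i: "i \<in> {1..k}" "dmin k p x = \<bar>x - p i\<bar>" using dmin_attained[OF k] .
    moreover have "i \<noteq> j"
    proof
      assume "i = j"
      then have "\<bar>x - s\<bar> \<le> \<bar>x - p l\<bar>" if "l \<in> {1..k}" for l
        using dmin_le[OF that, of p x] i by (simp add: s_def)
      with False show False by (auto simp: A_def)
    qed
    ultimately show ?thesis using dmin_le[OF i(1), of "p(j := u)" x] False by (simp add: h_def)
  qed
  have cost_h: "cost M k (p(j := u)) \<le> cost M k p + (\<integral>x. h u x \<partial>M)" for u
  proof -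
    have "cost M k (p(j := u)) \<le> (\<integral>x. dmin k p x + h u x \<partial>M)"
      unfolding cost_def using integrable_dmin[OF k] int_h key by (intro integral_mono) auto
    also have "\<dots> = cost M k p + (\<integral>x. h u x \<partial>M)"
      using integrable_dmin[OF k] int_h by (simp add: cost_def)
    finally show ?thesis .
  qed
  have cdf_split: "measure M (A \<inter> {..<u}) \<le> measure M (A \<inter> {..s}) + (cdf M u - cdf M s)" if "u > s" for u
  proof -
    have "measure M (A \<inter> {..<u}) \<le> measure M ((A \<inter> {..s}) \<union> {s<..u})"
      by (rule finite_measure_mono) auto
    also have "\<dots> \<le> measure M (A \<inter> {..s}) + measure M {s<..u}"
      by (rule measure_Un_le) auto
    finally show ?thesis by (simp add: cdf_diff_eq[OF that])
  qed
  \<comment> \<open>On the cell the change is at most \<open>u - s\<close> left of \<open>u\<close>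
    and exactly \<open>s - u\<close> from \<open>u\<close> on.\<close>
  have med': "measure M A \<le> 2 * (measure M (A \<inter> {..s}) + (cdf M u - cdf M s))" if u: "u > s" for u
  proof -
    have "0 \<le> (\<integral>x. h u x \<partial>M)" using cost_h[of u] opt[of "p(j := u)"] by linarith
    also have "\<dots> \<le> (\<integral>x. (u - s) * (2 * indicator (A \<inter> {..<u}) x - indicator A x) \<partial>M)"
    proof (intro integral_mono int_h)
      show "integrable M (\<lambda>x. (u - s) * (2 * indicator (A \<inter> {..<u}) x - indicator A x))"
        by (intro integrable_mult_right Bochner_Integration.integrable_diff integrable_indicat_sets) auto
    qed (use u in \<open>auto simp: h_def split: split_indicator\<close>)
    also have "\<dots> = (u - s) * (2 * measure M (A \<inter> {..<u}) - measure M A)" by (simp add: integrable_indicat_sets)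
    finally have "measure M A \<le> 2 * measure M (A \<inter> {..<u})"
      using u by (simp add: zero_le_mult_iff)
    with cdf_split[OF u] show ?thesis by simp
  qed
  \<comment> \<open>Let \<open>u\<close> decrease to \<open>s\<close>; right continuity of the cdf
    removes the mass between them.\<close>
  have med: "measure M A \<le> 2 * measure M (A \<inter> {..s})"
  proof (rule tendsto_lowerbound[where F = "at_right s"])
    have "(cdf M \<longlongrightarrow> cdf M s) (at_right s)"
      using cdf_is_right_cont[of s] by (simp add: continuous_within)
    then have "((\<lambda>u. 2 * (measure M (A \<inter> {..s}) + (cdf M u - cdf M s))) \<longlongrightarrow>
        2 * (measure M (A \<inter> {..s}) + (cdf M s - cdf M s))) (at_right s)"
      by (intro tendsto_intros)
    then show "((\<lambda>u. 2 * (measure M (A \<inter> {..s}) + (cdf M u - cdf M s))) \<longlongrightarrow>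
        2 * measure M (A \<inter> {..s})) (at_right s)" by simp
    show "\<forall>\<^sub>F u in at_right s. measure M A \<le> 2 * (measure M (A \<inter> {..s}) + (cdf M u - cdf M s))"
      using med' by (auto simp: eventually_at_filter)
  qed simp
  have "(\<integral>x. h t x \<partial>M) \<le> 0"
  proof (cases "cdf M s = 0")
    case True
    have "measure M (A \<inter> {..s}) \<le> cdf M s" unfolding cdf_def by (rule finite_measure_mono) auto
    with med True have "measure M A = 0" using measure_nonneg[of M A] by linarith
    moreover have "(\<integral>x. h t x \<partial>M) \<le> (\<integral>x. indicator A x * \<bar>t - s\<bar> \<partial>M)"
      by (intro integral_mono int_h) (auto simp: h_def integrable_indicat_sets split: split_indicator)
    ultimately show ?thesis by simp
  next
    case False
    then have ts: "t \<le> s" "cdf M t = cdf M s" using t by (auto simp: s_def)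
    \<comment> \<open>The gap carries no mass, so almost surely on the cell the change is
      \<open>t - s\<close> left of the gap and \<open>s - t\<close> right of it.\<close>
    have "AE x in M. x \<notin> {t<..s}"
    proof (cases "t = s")
      case False
      then have "measure M {t<..s} = 0" using cdf_diff_eq[of t s] ts by simp
      then show ?thesis by (intro AE_not_in) (auto simp: null_sets_def emeasure_eq_measure)
    qed simp
    then have "AE x in M. h t x \<le> (s - t) * (indicator A x - 2 * indicator (A \<inter> {..s}) x)"
      by eventually_elim (use ts(1) in \<open>auto simp: h_def split: split_indicator\<close>)
    then have "(\<integral>x. h t x \<partial>M) \<le> (\<integral>x. (s - t) * (indicator A x - 2 * indicator (A \<inter> {..s}) x) \<partial>M)"
      by (intro integral_mono_AE int_h integrable_mult_right Bochner_Integration.integrable_diff integrable_indicat_sets) auto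
    also have "\<dots> = (s - t) * (measure M A - 2 * measure M (A \<inter> {..s}))"
      by (simp add: integrable_indicat_sets)
    also have "\<dots> \<le> 0" using ts(1) med by (intro mult_nonneg_nonpos) auto
    finally show ?thesis .
  qed
  with cost_h[of t] show ?thesis by linarith
qed

text \<open>Facilities are moved one at a time. Each intermediate configuration costs no more than
  the optimal \<open>p\<close>, hence is optimal itself, and the one-step lemma applies
  again.\<close>

lemma cost_shift:
  assumes k: "k \<ge> 1" and opt: "\<And>r. cost M k p \<le> cost M k r"
    and t: "\<And>j. j \<in> {1..k} \<Longrightarrow> cdf M (p j) = 0 \<or> (r j \<le> p j \<and> cdf M (r j) = cdf M (p j))"
  shows "cost M k r \<le> cost M k p"
proof -
  define q where "q J i = (if i \<in> {1..J} then r i else p i)" for J :: nat and i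
  have "J \<le> k \<Longrightarrow> cost M k (q J) \<le> cost M k p" for J
  proof (induction J)
    case 0
    have "q 0 = p" by (auto simp: q_def)
    then show ?case by simp
  next
    case (Suc J)
    then have IH: "cost M k (q J) \<le> cost M k p" by simp
    have e: "q (Suc J) = (q J)(Suc J := r (Suc J))" by (auto simp: q_def)
    have J: "Suc J \<in> {1..k}" using Suc.prems by simp
    have "cost M k (q (Suc J)) \<le> cost M k (q J)"
      unfolding e
    proof (rule cost_shift_one[OF k J])
      show "cost M k (q J) \<le> cost M k r'" for r' using IH opt[of r'] by linarith
      show "cdf M (q J (Suc J)) = 0 \<or> r (Suc J) \<le> q J (Suc J) \<and> cdf M (r (Suc J)) = cdf M (q J (Suc J))"
        using t[OF J] by (simp add: q_def)
    qed
    with IH show ?case by linarith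
  qed
  from this[of k] have "cost M k (q k) \<le> cost M k p" by simp
  moreover have "dmin k (q k) x = dmin k r x" for x
    unfolding dmin_def by (rule arg_cong[where f = Min]) (auto simp: q_def)
  then have "cost M k (q k) = cost M k r" by (simp add: cost_def)
  ultimately show ?thesis by simp
qed

end

section \<open>Sample quantiles\<close>

lemma sorted_nth_le_iff:
  fixes l :: "'a::linorder list"
  assumes "sorted l" "i < length l"
  shows "l ! i \<le> t \<longleftrightarrow> i < length (filter (\<lambda>x. x \<le> t) l)"
  using assms
proof (induction l arbitrary: i)
  case (Cons y l)
  show ?case
  proof (cases "y \<le> t")
    case True
    then show ?thesis using Cons by (cases i) auto
  next
    case False
    then have "filter (\<lambda>x. x \<le> t) (y # l) = []" using Cons.prems by (auto simp: filter_empty_conv)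
    moreover have "y \<le> (y # l) ! i" using Cons.prems by (cases i) auto
    ultimately show ?thesis using False by auto
  qed
qed simp

text \<open>This is \<open>n\<close> times the empirical distribution function, written as a sum of
  indicators so that its moments expand termwise.\<close>

definition ecount :: "nat \<Rightarrow> (nat \<Rightarrow> real) \<Rightarrow> real \<Rightarrow> real" where
  "ecount n x t = (\<Sum>i<n. indicator {..t} (x i))"

text \<open>This duality turns statements on order statistics into statements on counts, whose
  moments are computable. Ties need no separate treatment.\<close>

lemma ordstat_le_iff:
  assumes "1 \<le> m" "m \<le> n"
  shows "ordstat n x m \<le> t \<longleftrightarrow> real m \<le> ecount n x t"
proof -
  let ?l = "map x [0..<n]"
  have "ordstat n x m \<le> t \<longleftrightarrow> m - 1 < length (filter (\<lambda>x. x \<le> t) (sort ?l))"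
    unfolding ordstat_def using assms by (intro sorted_nth_le_iff) auto
  also have "length (filter (\<lambda>x. x \<le> t) (sort ?l)) = length (filter (\<lambda>x. x \<le> t) ?l)"
    by (simp add: filter_sort)
  also have "\<dots> = card {i. i < n \<and> x i \<le> t}"
    by (subst length_filter_conv_card) (auto intro!: arg_cong[where f = card])
  also have "{i. i < n \<and> x i \<le> t} = {..<n} \<inter> {i. x i \<le> t}" by auto
  finally have "ordstat n x m \<le> t \<longleftrightarrow> m - 1 < card ({..<n} \<inter> {i. x i \<le> t})" .
  moreover have "real (card ({..<n} \<inter> {i. x i \<le> t})) = ecount n x t"
    by (simp add: ecount_def indicator_def sum.If_cases)
  ultimately show ?thesis using assms by linarith
qed

definition squantile :: "nat \<Rightarrow> real \<Rightarrow> (nat \<Rightarrow> real) \<Rightarrow> real" where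
  "squantile n v x = ordstat n x (nat \<lfloor>(real n - 1) * v\<rfloor> + 1)"

lemma PM_eq_squantile: "PM n v x j = squantile n (v j) x"
  by (simp add: PM_def squantile_def)

context
  fixes n :: nat and v :: real
  assumes n: "n \<ge> 1" and v: "0 \<le> v" "v \<le> 1"
begin

text \<open>The rank differs from \<open>n v\<close> by at most one, which is the source of the
  additive 1 in the tail bounds.\<close>

lemma quantile_index:
  shows "nat \<lfloor>(real n - 1) * v\<rfloor> + 1 \<le> n"
    "real n * v - 1 \<le> real (nat \<lfloor>(real n - 1) * v\<rfloor> + 1)"
    "real (nat \<lfloor>(real n - 1) * v\<rfloor>) \<le> real n * v"
proof -
  have 0: "0 \<le> (real n - 1) * v" using n v by simp
  then have r: "real (nat \<lfloor>(real n - 1) * v\<rfloor>) = of_int \<lfloor>(real n - 1) * v\<rfloor>" by simp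
  have "(real n - 1) * v \<le> (real n - 1) * 1" using n v by (intro mult_left_mono) auto
  then have "real (nat \<lfloor>(real n - 1) * v\<rfloor>) < real n"
    unfolding r by (intro le_less_trans[OF of_int_floor_le]) simp
  then show "nat \<lfloor>(real n - 1) * v\<rfloor> + 1 \<le> n" by simp
  have "(real n - 1) * v = real n * v - v" by (simp add: algebra_simps)
  then show "real n * v - 1 \<le> real (nat \<lfloor>(real n - 1) * v\<rfloor> + 1)"
    "real (nat \<lfloor>(real n - 1) * v\<rfloor>) \<le> real n * v"
    using r v floor_correct[of "(real n - 1) * v"] by (simp_all, linarith+)
qed

lemma squantile_le_iff: "squantile n v x \<le> t \<longleftrightarrow> real (nat \<lfloor>(real n - 1) * v\<rfloor> + 1) \<le> ecount n x t"
  unfolding squantile_def using quantile_index(1) by (intro ordstat_le_iff) auto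

lemma squantile_leD: "squantile n v x \<le> t \<Longrightarrow> real n * v - 1 \<le> ecount n x t"
  using squantile_le_iff quantile_index(2) by force

lemma ecount_Nats: "\<exists>c. ecount n x t = real c"
  unfolding ecount_def
  by (rule exI[of _ "card ({..<n} \<inter> {i. x i \<le> t})"]) (simp add: indicator_def sum.If_cases)

text \<open>The count is an integer below the rank, hence at most the rank minus one; this gains
  back the unit by which the rank may exceed \<open>n v\<close>.\<close>

lemma squantile_gtD:
  assumes "t < squantile n v x"
  shows "ecount n x t \<le> real n * v"
proof -
  obtain c where c: "ecount n x t = real c" using ecount_Nats by blast
  have "c < nat \<lfloor>(real n - 1) * v\<rfloor> + 1" using assms squantile_le_iff[of x t] c by simp
  then have "c \<le> nat \<lfloor>(real n - 1) * v\<rfloor>" by simp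
  then show ?thesis using c quantile_index(3) by simp
qed

lemma squantile_bounds:
  assumes "\<And>i. i < n \<Longrightarrow> a \<le> x i \<and> x i \<le> b"
  shows "a \<le> squantile n v x" "squantile n v x \<le> b"
proof -
  have "ecount n x b = (\<Sum>i<n. 1)" unfolding ecount_def
    by (rule sum.cong) (use assms in auto)
  then show "squantile n v x \<le> b" using squantile_le_iff quantile_index(1) by simp
  have "ecount n x t = 0" if "t < a" for t
    unfolding ecount_def by (rule sum.neutral) (use assms that in force)
  then show "a \<le> squantile n v x"
    using squantile_le_iff[of x] by (metis linorder_not_less of_nat_0_less_iff add_gr_0 zero_less_one order_refl)
qed

end

text \<open>Together with \<open>squantile_zero_le\<close> this says that the levels 1 and 0 select
  the sample extremes, which replaces a rate of convergence at the ends of the support.\<close>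

lemma squantile_one_ge:
  assumes "i < n"
  shows "x i \<le> squantile n 1 x"
proof (rule ccontr)
  assume "\<not> x i \<le> squantile n 1 x"
  have n: "n \<ge> 1" using assms by simp
  have "\<lfloor>real n - 1\<rfloor> = int n - 1" using floor_of_int[of "int n - 1"] by simp
  then have "nat \<lfloor>(real n - 1) * 1\<rfloor> + 1 = n" using n by simp
  then have "real n \<le> ecount n x (squantile n 1 x)"
    using squantile_le_iff[of n 1 x "squantile n 1 x"] n by simp
  also have "\<dots> < (\<Sum>i<n. 1)"
    unfolding ecount_def using assms \<open>\<not> x i \<le> squantile n 1 x\<close>
    by (intro sum_strict_mono_ex1) (auto split: split_indicator)
  finally show False by simp
qed

lemma squantile_zero_le:
  assumes "i < n"
  shows "squantile n 0 x \<le> x i"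
proof -
  have "indicator {..x i} (x i) \<le> ecount n x (x i)"
    unfolding ecount_def using assms by (intro member_le_sum) auto
  then show ?thesis using squantile_le_iff[of n 0 x "x i"] assms by simp
qed

section \<open>Moments and tails of the empirical distribution function\<close>

context real_distribution
begin

lemma prob_space_sample: "prob_space (sample M n)"
  unfolding sample_def by (intro prob_space_PiM prob_space_axioms)

lemma measurable_sample_coord [measurable]: "i < n \<Longrightarrow> (\<lambda>x. x i) \<in> borel_measurable (sample M n)"
  using measurable_component_singleton[of i "{..<n}" "\<lambda>_. M"] unfolding sample_def
  by simp

lemma distr_sample_coord: "i < n \<Longrightarrow> distr (sample M n) borel (\<lambda>x. x i) = M"
proof -
  assume i: "i < n"
  have "distr (sample M n) borel (\<lambda>x. x i) = distr (sample M n) M (\<lambda>x. x i)"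
    by (rule distr_cong) auto
  also have "\<dots> = M" unfolding sample_def
    using i prob_space_axioms by (intro distr_PiM_component) auto
  finally show ?thesis .
qed

lemma integral_sample_coord:
  fixes g :: "real \<Rightarrow> real"
  assumes "i < n" "g \<in> borel_measurable borel"
  shows "(\<integral>x. g (x i) \<partial>sample M n) = (\<integral>x. g x \<partial>M)"
  using integral_distr[OF measurable_sample_coord[OF assms(1)] assms(2)]
  by (simp add: distr_sample_coord[OF assms(1)])

lemma integrable_sample_coord:
  fixes g :: "real \<Rightarrow> real"
  assumes "i < n" "g \<in> borel_measurable borel" "integrable M g"
  shows "integrable (sample M n) (\<lambda>x. g (x i))"
  using integrable_distr_eq[OF measurable_sample_coord[OF assms(1)] assms(2)] assms(3)
  by (simp add: distr_sample_coord[OF assms(1)])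

lemma AE_sample:
  assumes "AE x in M. P x"
  shows "AE x in sample M n. \<forall>i<n. P (x i)"
proof -
  have "AE x in sample M n. \<forall>i\<in>{..<n}. P (x i)"
    unfolding sample_def using assms prob_space_axioms
    by (intro AE_finite_allI) (auto intro: AE_PiM_component)
  then show ?thesis by (rule eventually_mono) simp
qed

text \<open>Independence, obtained by integrating a product of functions that are \<open>g\<close>
  at \<open>i\<close> and \<open>j\<close> and constantly 1 at the other coordinates.\<close>

lemma integral_sample_prod_coord:
  fixes g :: "real \<Rightarrow> real"
  assumes g: "integrable M g" and ij: "i < n" "j < n" "i \<noteq> j"
  shows "integrable (sample M n) (\<lambda>x. g (x i) * g (x j))"
    "(\<integral>x. g (x i) * g (x j) \<partial>sample M n) = (\<integral>x. g x \<partial>M) * (\<integral>x. g x \<partial>M)"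
proof -
  interpret product_sigma_finite "\<lambda>_::nat. M"
    by standard
  define f where "f l y = (if l = i \<or> l = j then g y else 1)" for l y
  have f: "integrable M (f l)" for l
    unfolding f_def[abs_def] using g by (cases "l = i \<or> l = j") auto
  have pr: "(\<Prod>l<n. if l = i \<or> l = j then h l else (1::real)) = h i * h j" for h
  proof -
    have "(\<Prod>l<n. if l = i \<or> l = j then h l else (1::real)) = (\<Prod>l<n. (if l = i then h l else 1) * (if l = j then h l else 1))"
      by (rule prod.cong) (use ij in auto)
    also have "\<dots> = h i * h j" using ij by (simp add: prod.distrib)
    finally show ?thesis .
  qed
  have e: "(\<Prod>l<n. f l (x l)) = g (x i) * g (x j)" for x
    unfolding f_def by (rule pr)
  have e2: "(\<Prod>l<n. \<integral>y. f l y \<partial>M) = (\<integral>x. g x \<partial>M) * (\<integral>x. g x \<partial>M)"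
  proof -
    have "(\<Prod>l<n. \<integral>y. f l y \<partial>M) = (\<Prod>l<n. if l = i \<or> l = j then (\<integral>x. g x \<partial>M) else 1)"
      by (rule prod.cong) (use prob_space in \<open>auto simp: f_def\<close>)
    then show ?thesis by (simp add: pr)
  qed
  show "integrable (sample M n) (\<lambda>x. g (x i) * g (x j))"
    using product_integrable_prod[of "{..<n}" f] f unfolding sample_def e by simp
  show "(\<integral>x. g (x i) * g (x j) \<partial>sample M n) = (\<integral>x. g x \<partial>M) * (\<integral>x. g x \<partial>M)"
    using product_integral_prod[of "{..<n}" f] f unfolding sample_def e e2 by simp
qed

text \<open>A bound on the binomial variance: in the expanded square of the centred sum the mixed
  terms vanish by independence, and each of the \<open>n\<close> diagonal terms is at most
  1.\<close>

lemma ecount_second_moment: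
  shows "integrable (sample M n) (\<lambda>x. (ecount n x t - real n * cdf M t)\<^sup>2)"
    "(\<integral>x. (ecount n x t - real n * cdf M t)\<^sup>2 \<partial>sample M n) \<le> real n"
proof -
  define g where "g x = indicator {..t} x - cdf M t" for x
  have [measurable]: "g \<in> borel_measurable borel" unfolding g_def[abs_def] by measurable
  have g: "integrable M g" unfolding g_def[abs_def]
    by (intro Bochner_Integration.integrable_diff integrable_indicat_sets) auto
  have g0: "(\<integral>x. g x \<partial>M) = 0" using prob_space by (simp add: g_def cdf_def integrable_indicat_sets)
  have g1: "\<bar>g x\<bar> \<le> 1" for x
    using cdf_nonneg[of t] cdf_bounded_prob[of t] by (auto simp: g_def split: split_indicator)
  have gg: "g x * g x \<le> 1" for x using g1[of x] by (simp add: abs_le_square_iff[of _ 1, simplified] power2_eq_square[symmetric])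
  have gg_int: "integrable M (\<lambda>x. g x * g x)"
    by (rule integrable_const_bound[where B = 1]) (use gg in auto)
  have e: "(ecount n x t - real n * cdf M t)\<^sup>2 = (\<Sum>i<n. \<Sum>j<n. g (x i) * g (x j))" for x
  proof -
    have "ecount n x t - real n * cdf M t = (\<Sum>i<n. g (x i))"
      by (simp add: ecount_def g_def sum_subtractf)
    then show ?thesis by (simp add: power2_eq_square sum_product)
  qed
  have int: "integrable (sample M n) (\<lambda>x. g (x i) * g (x j))" if "i < n" "j < n" for i j
    using integral_sample_prod_coord(1)[OF g that] integrable_sample_coord[OF that(1) _ gg_int]
    by (cases "i = j") auto
  show "integrable (sample M n) (\<lambda>x. (ecount n x t - real n * cdf M t)\<^sup>2)"
    unfolding e using int by (intro Bochner_Integration.integrable_sum) auto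
  have "(\<integral>x. (ecount n x t - real n * cdf M t)\<^sup>2 \<partial>sample M n) =
      (\<Sum>i<n. \<Sum>j<n. \<integral>x. g (x i) * g (x j) \<partial>sample M n)"
    unfolding e using int
    by (subst Bochner_Integration.integral_sum)
      (auto intro!: sum.cong Bochner_Integration.integral_sum Bochner_Integration.integrable_sum)
  also have "\<dots> \<le> (\<Sum>i<n. \<Sum>j<n. if i = j then 1 else 0)"
  proof (intro sum_mono)
    fix i j assume ij: "i \<in> {..<n}" "j \<in> {..<n}"
    show "(\<integral>x. g (x i) * g (x j) \<partial>sample M n) \<le> (if i = j then 1 else 0)"
    proof (cases "i = j")
      case True
      have "(\<integral>x. g (x i) * g (x i) \<partial>sample M n) = (\<integral>x. g x * g x \<partial>M)"
        using ij integral_sample_coord[of i n "\<lambda>x. g x * g x"] by simp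
      also have "\<dots> \<le> (\<integral>x. 1 \<partial>M)" using gg gg_int by (intro integral_mono) auto
      finally show ?thesis using True prob_space by simp
    next
      case False
      then show ?thesis using integral_sample_prod_coord(2)[OF g, of i n j] ij g0 by simp
    qed
  qed
  also have "\<dots> = real n" by simp
  finally show "(\<integral>x. (ecount n x t - real n * cdf M t)\<^sup>2 \<partial>sample M n) \<le> real n" .
qed

lemma ecount_measurable [measurable]: "(\<lambda>x. ecount n x t) \<in> borel_measurable (sample M n)"
  unfolding ecount_def by (intro borel_measurable_sum) measurable

lemma ecount_mean_deviation:
  assumes "n \<ge> 1"
  shows "integrable (sample M n) (\<lambda>x. \<bar>ecount n x t / real n - cdf M t\<bar>)"
    "(\<integral>x. \<bar>ecount n x t / real n - cdf M t\<bar> \<partial>sample M n) \<le> 1 / sqrt (real n)"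
proof -
  interpret S: prob_space "sample M n" by (rule prob_space_sample)
  let ?Z = "\<lambda>x. (ecount n x t - real n * cdf M t)"
  have s: "sqrt (real n) > 0" "sqrt (real n) * sqrt (real n) = real n" using assms by auto
  have n0: "real n > 0" using assms by simp
  \<comment> \<open>AM-GM replaces Cauchy--Schwarz: \<open>2 \<bar>Z\<bar> \<surd>n \<le> Z\<^sup>2 + n\<close>.\<close>
  have amgm: "\<bar>ecount n x t / real n - cdf M t\<bar> \<le> (?Z x)\<^sup>2 / (2 * real n * sqrt (real n)) + 1 / (2 * sqrt (real n))" for x
  proof -
    have "0 \<le> (\<bar>?Z x\<bar> - sqrt (real n))\<^sup>2" by simp
    then have "2 * (\<bar>?Z x\<bar> * sqrt (real n)) \<le> (?Z x)\<^sup>2 + real n"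
      using s by (simp add: power2_diff algebra_simps)
    then have "2 * (\<bar>?Z x\<bar> * sqrt (real n)) / (2 * real n * sqrt (real n)) \<le> ((?Z x)\<^sup>2 + real n) / (2 * real n * sqrt (real n))"
      using n0 by (intro divide_right_mono) auto
    also have "2 * (\<bar>?Z x\<bar> * sqrt (real n)) / (2 * real n * sqrt (real n)) = \<bar>?Z x / real n\<bar>"
      using n0 by simp
    also have "?Z x / real n = ecount n x t / real n - cdf M t"
      using n0 by (simp add: field_simps)
    finally show ?thesis using n0 by (simp add: add_divide_distrib)
  qed
  have int: "integrable (sample M n) (\<lambda>x. (?Z x)\<^sup>2 / (2 * real n * sqrt (real n)) + 1 / (2 * sqrt (real n)))"
    using ecount_second_moment(1) by (intro Bochner_Integration.integrable_add integrable_divide) auto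
  show i: "integrable (sample M n) (\<lambda>x. \<bar>ecount n x t / real n - cdf M t\<bar>)"
    by (rule Bochner_Integration.integrable_bound[OF int]) (use amgm in \<open>auto intro!: order_trans[OF amgm]\<close>)
  have "(\<integral>x. \<bar>ecount n x t / real n - cdf M t\<bar> \<partial>sample M n) \<le>
     (\<integral>x. (?Z x)\<^sup>2 / (2 * real n * sqrt (real n)) + 1 / (2 * sqrt (real n)) \<partial>sample M n)"
    using i int amgm by (intro integral_mono) auto
  also have "\<dots> = (\<integral>x. (?Z x)\<^sup>2 \<partial>sample M n) / (2 * real n * sqrt (real n)) + 1 / (2 * sqrt (real n))"
    using ecount_second_moment(1)[of n t] S.prob_space by simp
  also have "\<dots> \<le> real n / (2 * real n * sqrt (real n)) + 1 / (2 * sqrt (real n))"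
    using ecount_second_moment(2)[of n t] n0 by (intro add_right_mono divide_right_mono) auto
  also have "\<dots> = 1 / sqrt (real n)" using n0 by (simp add: field_simps)
  finally show "(\<integral>x. \<bar>ecount n x t / real n - cdf M t\<bar> \<partial>sample M n) \<le> 1 / sqrt (real n)" .
qed

text \<open>Chebyshev's inequality. The additive 1 absorbs the rounding of the rank; it is paid for
  by \<open>(\<bar>Z\<bar> + 1)^2 \<le> 2 Z^2 + 2\<close> and \<open>2 n + 2 \<le> 4 n\<close>. The
  product form also covers \<open>d = 0\<close>.\<close>

lemma ecount_tail:
  assumes n: "n \<ge> 1" and E: "E \<in> sets (sample M n)" and d: "0 \<le> d"
    and dev: "\<And>x. x \<in> E \<Longrightarrow> real n * d \<le> \<bar>ecount n x t - real n * cdf M t\<bar> + 1"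
  shows "measure (sample M n) E * (real n * d\<^sup>2) \<le> 4"
proof -
  interpret S: prob_space "sample M n" by (rule prob_space_sample)
  let ?Z = "\<lambda>x. (ecount n x t - real n * cdf M t)"
  have pt: "indicator E x * (real n * d)\<^sup>2 \<le> 2 * (?Z x)\<^sup>2 + 2" for x
  proof (cases "x \<in> E")
    case True
    have "(real n * d)\<^sup>2 \<le> (\<bar>?Z x\<bar> + 1)\<^sup>2" using dev[OF True] d by (intro power_mono) auto
    also have "\<dots> \<le> 2 * (?Z x)\<^sup>2 + 2"
      using zero_le_power2[of "\<bar>?Z x\<bar> - 1"] power2_abs[of "?Z x"]
      by (simp only: power2_sum[of _ 1] power2_diff[of "\<bar>_\<bar>" 1]) simp
    finally show ?thesis using True by simp
  qed simp
  have "measure (sample M n) E * (real n * d)\<^sup>2 = (\<integral>x. indicator E x * (real n * d)\<^sup>2 \<partial>sample M n)"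
    using E by simp
  also have "\<dots> \<le> (\<integral>x. 2 * (?Z x)\<^sup>2 + 2 \<partial>sample M n)"
    using ecount_second_moment(1) pt S.integrable_indicat_sets[OF E] by (intro integral_mono) auto
  also have "\<dots> = 2 * (\<integral>x. (?Z x)\<^sup>2 \<partial>sample M n) + 2"
    using ecount_second_moment(1)[of n t] S.prob_space by simp
  also have "\<dots> \<le> 2 * real n + 2" using ecount_second_moment(2)[of n t] by simp
  also have "\<dots> \<le> 4 * real n" using n by simp
  finally have "real n * (measure (sample M n) E * (real n * d\<^sup>2)) \<le> real n * 4"
    by (simp add: power2_eq_square algebra_simps)
  then show ?thesis using n by simp
qed

section \<open>Tails and mean deviation of sample quantiles\<close>

lemma squantile_measurable [measurable]:
  assumes "n \<ge> 1" "0 \<le> v" "v \<le> 1"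
  shows "squantile n v \<in> borel_measurable (sample M n)"
  unfolding borel_measurable_iff_le squantile_le_iff[OF assms] by measurable

text \<open>If the sample quantile is at most \<open>t\<close>, the count at \<open>t\<close>
  exceeds its mean by at least \<open>n (v - cdf M t) - 1\<close>.\<close>

lemma squantile_lower_tail:
  assumes "n \<ge> 1" "0 \<le> v" "v \<le> 1" "cdf M t \<le> v"
  shows "measure (sample M n) {x \<in> space (sample M n). squantile n v x \<le> t} * (real n * (v - cdf M t)\<^sup>2) \<le> 4"
proof (rule ecount_tail[OF assms(1)])
  show "{x \<in> space (sample M n). squantile n v x \<le> t} \<in> sets (sample M n)"
    using assms by measurable
  show "real n * (v - cdf M t) \<le> \<bar>ecount n x t - real n * cdf M t\<bar> + 1"
    if "x \<in> {x \<in> space (sample M n). squantile n v x \<le> t}" for x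
    using squantile_leD[OF assms(1-3), of x t] that by (simp add: algebra_simps)
qed (use assms in simp)

lemma squantile_upper_tail:
  assumes "n \<ge> 1" "0 \<le> v" "v \<le> 1" "v \<le> cdf M t"
  shows "measure (sample M n) {x \<in> space (sample M n). t < squantile n v x} * (real n * (cdf M t - v)\<^sup>2) \<le> 4"
proof (rule ecount_tail[OF assms(1)])
  show "{x \<in> space (sample M n). t < squantile n v x} \<in> sets (sample M n)"
    using assms by measurable
  show "real n * (cdf M t - v) \<le> \<bar>ecount n x t - real n * cdf M t\<bar> + 1"
    if "x \<in> {x \<in> space (sample M n). t < squantile n v x}" for x
    using squantile_gtD[OF assms(1-3), of t x] that by (simp add: algebra_simps)
qed (use assms in simp)

end

lemma sum_inverse_squares_le: "(\<Sum>r=1..R. 1 / (real r)\<^sup>2) \<le> 2"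
proof -
  \<comment> \<open>The sharper bound \<open>2 - 1 / R\<close> lets the induction telescope.\<close>
  have "R \<ge> 1 \<Longrightarrow> (\<Sum>r=1..R. 1 / (real r)\<^sup>2) \<le> 2 - 1 / real R" for R
  proof (induction R rule: nat_induct_at_least)
    case (Suc R)
    have "1 / (real (Suc R))\<^sup>2 \<le> 1 / (real R * real (Suc R))"
      using Suc.hyps by (intro divide_left_mono) (auto simp: power2_eq_square)
    also have "\<dots> = 1 / real R - 1 / real (Suc R)" using Suc.hyps by (simp add: field_simps)
    finally show ?case using Suc.IH by simp
  qed simp
  from this[of R] show ?thesis
    by (cases "R = 0") (auto intro: order_trans simp: Suc_le_eq)
qed

text \<open>A discrete layer-cake formula: after integration the sum becomes a sum of tail
  probabilities. \<open>R\<close> only has to be large enough that no layer is missed.\<close>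

lemma layer_cake_sum:
  fixes u \<delta> :: real
  assumes "0 < \<delta>" "u \<le> real R * \<delta>"
  shows "u \<le> \<delta> * (1 + (\<Sum>r=1..R. of_bool (u > real r * \<delta>)))"
  using assms(2)
proof (induction R)
  case 0
  then show ?case using assms(1) by simp
next
  case (Suc R)
  show ?case
  proof (cases "u \<le> real R * \<delta>")
    case True
    have "u \<le> \<delta> * (1 + (\<Sum>r=1..R. of_bool (u > real r * \<delta>)))" using Suc.IH[OF True] .
    also have "\<dots> \<le> \<delta> * (1 + (\<Sum>r=1..Suc R. of_bool (u > real r * \<delta>)))"
      using assms(1) by (intro mult_left_mono add_left_mono sum_mono2) auto
    finally show ?thesis .
  next
    case False
    have "(\<Sum>r=1..R. 1) \<le> (\<Sum>r=1..R. of_bool (u > real r * \<delta>) :: real)"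
    proof (intro sum_mono)
      fix r assume "r \<in> {1..R}"
      then have "real r * \<delta> \<le> real R * \<delta>" using assms(1) by (intro mult_right_mono) auto
      then show "1 \<le> (of_bool (u > real r * \<delta>) :: real)" using False by auto
    qed
    also have "\<dots> \<le> (\<Sum>r=1..Suc R. of_bool (u > real r * \<delta>))" by (intro sum_mono2) auto
    finally have "real R \<le> (\<Sum>r=1..Suc R. of_bool (u > real r * \<delta>))" by simp
    then have "\<delta> * (1 + real R) \<le> \<delta> * (1 + (\<Sum>r=1..Suc R. of_bool (u > real r * \<delta>)))"
      using assms(1) by (intro mult_left_mono) auto
    with Suc.prems show ?thesis by (simp add: algebra_simps)
  qed
qed

context bounded_distribution
begin

lemma a_le_b: "a \<le> b"
proof -
  have "AE x in M. a \<le> b" using AE_bounds by eventually_elim simp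
  then show ?thesis by simp
qed

lemma AE_sample_bounds: "AE x in sample M n. \<forall>i<n. a \<le> x i \<and> x i \<le> b"
  using AE_sample[OF AE_bounds] .

lemma AE_squantile_bounds:
  assumes "n \<ge> 1" "0 \<le> v" "v \<le> 1"
  shows "AE x in sample M n. a \<le> squantile n v x \<and> squantile n v x \<le> b"
  using AE_sample_bounds
  by eventually_elim (use squantile_bounds[OF assms] in blast)

lemma integrable_squantile_dev:
  assumes "n \<ge> 1" "0 \<le> v" "v \<le> 1"
  shows "integrable (sample M n) (\<lambda>x. \<bar>squantile n v x - q\<bar>)"
proof -
  interpret S: prob_space "sample M n" by (rule prob_space_sample)
  note [measurable] = squantile_measurable[OF assms]
  show ?thesis
  proof (rule S.integrable_const_bound[where B = "\<bar>a\<bar> + \<bar>b\<bar> + \<bar>q\<bar>"])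
    show "AE x in sample M n. norm \<bar>squantile n v x - q\<bar> \<le> \<bar>a\<bar> + \<bar>b\<bar> + \<bar>q\<bar>"
      using AE_squantile_bounds[OF assms] by eventually_elim auto
  qed measurable
qed

text \<open>At distance \<open>r \<delta>\<close> from \<open>q\<close> the cdf has moved by at
  least \<open>r / sqrt n\<close>, so Chebyshev bounds each tail by \<open>4 / r^2\<close>. Summing
  the layers of both tails gives the factor 17 as \<open>1 + 8 * 2\<close>.\<close>

lemma squantile_expected_dev_rate:
  assumes n: "n \<ge> 1" and v: "0 \<le> v" "v \<le> 1" and q: "a \<le> q" "q \<le> b" "cdf M q = v"
    and K: "K > 0" "\<And>x. a \<le> x \<Longrightarrow> x \<le> b \<Longrightarrow> \<bar>x - q\<bar> \<le> K * \<bar>cdf M x - v\<bar>"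
  shows "(\<integral>x. \<bar>squantile n v x - q\<bar> \<partial>sample M n) \<le> 17 * K / sqrt (real n)"
proof -
  interpret S: prob_space "sample M n" by (rule prob_space_sample)
  note [measurable] = squantile_measurable[OF n v]
  \<comment> \<open>The layer width at which \<open>n\<close> cancels in Chebyshev's bound; see
    \<open>scale\<close>.\<close>
  define \<delta> where "\<delta> = K / sqrt (real n)"
  have \<delta>: "\<delta> > 0" using K n by (simp add: \<delta>_def)
  obtain R :: nat where R: "b - a \<le> real R * \<delta>"
    using reals_Archimedean3[OF \<delta>] by (meson less_imp_le)
  let ?E = "\<lambda>r::nat. {x \<in> space (sample M n). \<bar>squantile n v x - q\<bar> > real r * \<delta>}"
  let ?L = "\<lambda>r::nat. {x \<in> space (sample M n). squantile n v x \<le> q - real r * \<delta>}"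
  let ?U = "\<lambda>r::nat. {x \<in> space (sample M n). q + real r * \<delta> < squantile n v x}"
  have scale: "real n * (real r * \<delta> / K)\<^sup>2 = (real r)\<^sup>2" for r :: nat
    using n K by (simp add: \<delta>_def power_divide)
  have L: "S.prob (?L r) \<le> 4 / (real r)\<^sup>2" if r: "r \<ge> 1" for r
  proof (cases "a \<le> q - real r * \<delta>")
    case True
    let ?t = "q - real r * \<delta>"
    have t: "?t \<le> q" using \<delta> by simp
    then have le: "cdf M ?t \<le> v" using cdf_nondecreasing[OF t] q by simp
    then have "real r * \<delta> \<le> K * (v - cdf M ?t)" using K(2)[OF True] q t \<delta> by simp
    then have "(real r * \<delta> / K)\<^sup>2 \<le> (v - cdf M ?t)\<^sup>2"
      using K(1) \<delta> by (intro power_mono) (auto simp: field_simps)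
    then have "(real r)\<^sup>2 \<le> real n * (v - cdf M ?t)\<^sup>2"
      unfolding scale[symmetric] by (intro mult_left_mono) auto
    then have "S.prob (?L r) * (real r)\<^sup>2 \<le> S.prob (?L r) * (real n * (v - cdf M ?t)\<^sup>2)"
      by (intro mult_left_mono) auto
    also have "\<dots> \<le> 4" by (rule squantile_lower_tail[OF n v le])
    finally show ?thesis using r by (simp add: field_simps)
  next
    \<comment> \<open>Outside [a, b] the hypothesis on \<open>K\<close> says nothing, but the sample
      quantile almost surely stays inside.\<close>
    case False
    have "AE x in sample M n. x \<notin> ?L r"
      using AE_squantile_bounds[OF n v] by eventually_elim (use False in auto)
    then have "S.prob (?L r) = 0" by (subst S.prob_eq_0) auto
    then show ?thesis by simp
  qed
  have U: "S.prob (?U r) \<le> 4 / (real r)\<^sup>2" if r: "r \<ge> 1" for r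
  proof (cases "q + real r * \<delta> \<le> b")
    case True
    let ?t = "q + real r * \<delta>"
    have t: "q \<le> ?t" using \<delta> by simp
    then have le: "v \<le> cdf M ?t" using cdf_nondecreasing[OF t] q by simp
    then have "real r * \<delta> \<le> K * (cdf M ?t - v)" using K(2)[OF _ True] q t \<delta> by simp
    then have "(real r * \<delta> / K)\<^sup>2 \<le> (cdf M ?t - v)\<^sup>2"
      using K(1) \<delta> by (intro power_mono) (auto simp: field_simps)
    then have "(real r)\<^sup>2 \<le> real n * (cdf M ?t - v)\<^sup>2"
      unfolding scale[symmetric] by (intro mult_left_mono) auto
    then have "S.prob (?U r) * (real r)\<^sup>2 \<le> S.prob (?U r) * (real n * (cdf M ?t - v)\<^sup>2)"
      by (intro mult_left_mono) auto
    also have "\<dots> \<le> 4" by (rule squantile_upper_tail[OF n v le])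
    finally show ?thesis using r by (simp add: field_simps)
  next
    case False
    have "AE x in sample M n. x \<notin> ?U r"
      using AE_squantile_bounds[OF n v] by eventually_elim (use False in auto)
    then have "S.prob (?U r) = 0" by (subst S.prob_eq_0) auto
    then show ?thesis by simp
  qed
  have E: "S.prob (?E r) \<le> 8 / (real r)\<^sup>2" if r: "r \<ge> 1" for r
  proof -
    have "S.prob (?E r) \<le> S.prob (?L r \<union> ?U r)"
      by (intro S.finite_measure_mono) auto
    also have "\<dots> \<le> S.prob (?L r) + S.prob (?U r)"
      by (intro measure_Un_le) auto
    also have "\<dots> \<le> 4 / (real r)\<^sup>2 + 4 / (real r)\<^sup>2" by (intro add_mono L U r)
    finally show ?thesis by simp
  qed
  have "(\<integral>x. \<bar>squantile n v x - q\<bar> \<partial>sample M n) \<le> (\<integral>x. \<delta> * (1 + (\<Sum>r=1..R. indicator (?E r) x)) \<partial>sample M n)"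
  proof (rule integral_mono_AE)
    show "integrable (sample M n) (\<lambda>x. \<bar>squantile n v x - q\<bar>)" by (rule integrable_squantile_dev[OF n v])
    show "integrable (sample M n) (\<lambda>x. \<delta> * (1 + (\<Sum>r=1..R. indicator (?E r) x)))"
      by (intro integrable_mult_right Bochner_Integration.integrable_add Bochner_Integration.integrable_sum S.integrable_indicat_sets) auto
    show "AE x in sample M n. \<bar>squantile n v x - q\<bar> \<le> \<delta> * (1 + (\<Sum>r=1..R. indicator (?E r) x))"
      using AE_squantile_bounds[OF n v] AE_space
    proof eventually_elim
      case (elim x)
      have "\<bar>squantile n v x - q\<bar> \<le> real R * \<delta>" using elim q R by auto
      from layer_cake_sum[OF \<delta> this] show ?case using elim by (simp add: indicator_def of_bool_def)
    qed
  qed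
  also have "\<dots> = \<delta> * (1 + (\<Sum>r=1..R. S.prob (?E r)))"
  proof -
    have "(\<integral>x. (\<Sum>r=1..R. indicator (?E r) x) \<partial>sample M n) = (\<Sum>r=1..R. S.prob (?E r))"
      by (subst Bochner_Integration.integral_sum) (auto intro!: S.integrable_indicat_sets sum.cong)
    moreover have "integrable (sample M n) (\<lambda>x. (\<Sum>r=1..R. indicat_real (?E r) x))"
      by (intro Bochner_Integration.integrable_sum S.integrable_indicat_sets) auto
    ultimately show ?thesis using S.prob_space by simp
  qed
  also have "\<dots> \<le> \<delta> * (1 + (\<Sum>r=1..R. 8 * (1 / (real r)\<^sup>2)))"
    using \<delta> E by (intro mult_left_mono add_left_mono sum_mono) auto
  also have "\<dots> \<le> \<delta> * (1 + 8 * 2)"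
    using \<delta> sum_inverse_squares_le[of R] unfolding sum_distrib_left[symmetric]
    by (intro mult_left_mono add_left_mono) auto
  finally show ?thesis by (simp add: \<delta>_def mult.commute)
qed

text \<open>The first alternative covers level 0, where no cdf value is below \<open>v\<close>: left
  of \<open>a\<close> the event is null.\<close>

lemma squantile_lower_prob_tendsto:
  assumes v: "0 \<le> v" "v \<le> 1" and t: "t < a \<or> cdf M t < v"
  shows "(\<lambda>n. measure (sample M n) {x \<in> space (sample M n). squantile n v x \<le> t}) \<longlonglongrightarrow> 0"
proof (cases "t < a")
  case True
  have "measure (sample M n) {x \<in> space (sample M n). squantile n v x \<le> t} = 0" if n: "n \<ge> 1" for n
  proof -
    interpret S: prob_space "sample M n" by (rule prob_space_sample)
    note [measurable] = squantile_measurable[OF n v]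
    show ?thesis by (subst S.prob_eq_0) (use AE_squantile_bounds[OF n v] True in auto)
  qed
  then show ?thesis by (intro tendsto_eventually eventually_sequentiallyI[of 1])
next
  case False
  then have d: "v - cdf M t > 0" using t by simp
  show ?thesis
  proof (rule tendsto_sandwich[OF _ _ tendsto_const])
    show "(\<lambda>n. (4 / (v - cdf M t)\<^sup>2) / real n) \<longlonglongrightarrow> 0"
      by (rule lim_const_over_n)
    show "\<forall>\<^sub>F n in sequentially. measure (sample M n) {x \<in> space (sample M n). squantile n v x \<le> t} \<le> (4 / (v - cdf M t)\<^sup>2) / real n"
    proof (rule eventually_sequentiallyI[of 1])
      fix n :: nat assume n: "n \<ge> 1"
      show "measure (sample M n) {x \<in> space (sample M n). squantile n v x \<le> t} \<le> (4 / (v - cdf M t)\<^sup>2) / real n"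
        using squantile_lower_tail[OF n v, of t] n d by (simp add: field_simps)
    qed
  qed simp
qed

lemma squantile_upper_prob_tendsto:
  assumes v: "0 \<le> v" "v \<le> 1" and t: "t \<ge> b \<or> cdf M t > v"
  shows "(\<lambda>n. measure (sample M n) {x \<in> space (sample M n). t < squantile n v x}) \<longlonglongrightarrow> 0"
proof (cases "t \<ge> b")
  case True
  have "measure (sample M n) {x \<in> space (sample M n). t < squantile n v x} = 0" if n: "n \<ge> 1" for n
  proof -
    interpret S: prob_space "sample M n" by (rule prob_space_sample)
    note [measurable] = squantile_measurable[OF n v]
    show ?thesis by (subst S.prob_eq_0) (use AE_squantile_bounds[OF n v] True in auto)
  qed
  then show ?thesis by (intro tendsto_eventually eventually_sequentiallyI[of 1])
next
  case False
  then have d: "cdf M t - v > 0" using t by simp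
  show ?thesis
  proof (rule tendsto_sandwich[OF _ _ tendsto_const])
    show "(\<lambda>n. (4 / (cdf M t - v)\<^sup>2) / real n) \<longlonglongrightarrow> 0"
      by (rule lim_const_over_n)
    show "\<forall>\<^sub>F n in sequentially. measure (sample M n) {x \<in> space (sample M n). t < squantile n v x} \<le> (4 / (cdf M t - v)\<^sup>2) / real n"
    proof (rule eventually_sequentiallyI[of 1])
      fix n :: nat assume n: "n \<ge> 1"
      show "measure (sample M n) {x \<in> space (sample M n). t < squantile n v x} \<le> (4 / (cdf M t - v)\<^sup>2) / real n"
        using squantile_upper_tail[OF n v, of t] n d by (simp add: field_simps)
    qed
  qed simp
qed

text \<open>Consistency without a rate, from strict monotonicity, hence valid at the levels 0 and 1
  as well. Up to \<epsilon>, the deviation is at most \<open>b - a\<close> times the indicators of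
  two events of vanishing probability.\<close>

lemma squantile_expected_dev_tendsto:
  assumes v: "0 \<le> v" "v \<le> 1" and q: "a \<le> q" "q \<le> b" "cdf M q = v"
    and mono: "\<And>s t. a \<le> s \<Longrightarrow> s < t \<Longrightarrow> t \<le> b \<Longrightarrow> cdf M s < cdf M t"
  shows "(\<lambda>n. \<integral>x. \<bar>squantile n v x - q\<bar> \<partial>sample M n) \<longlonglongrightarrow> 0"
proof (rule order_tendstoI)
  fix y :: real assume "y < 0"
  then show "\<forall>\<^sub>F n in sequentially. y < (\<integral>x. \<bar>squantile n v x - q\<bar> \<partial>sample M n)"
    by (intro always_eventually allI less_le_trans[OF _ integral_nonneg_AE]) auto
next
  fix e :: real assume e: "0 < e"
  define \<epsilon> where "\<epsilon> = e / 2"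
  have \<epsilon>: "\<epsilon> > 0" using e by (simp add: \<epsilon>_def)
  let ?L = "\<lambda>n. {x \<in> space (sample M n). squantile n v x \<le> q - \<epsilon>}"
  let ?U = "\<lambda>n. {x \<in> space (sample M n). q + \<epsilon> < squantile n v x}"
  have "(\<lambda>n. measure (sample M n) (?L n)) \<longlonglongrightarrow> 0"
    by (rule squantile_lower_prob_tendsto[OF v]) (use mono[of "q - \<epsilon>" q] \<epsilon> q in force)
  moreover have "(\<lambda>n. measure (sample M n) (?U n)) \<longlonglongrightarrow> 0"
    by (rule squantile_upper_prob_tendsto[OF v]) (use mono[of q "q + \<epsilon>"] \<epsilon> q in force)
  ultimately have "(\<lambda>n. \<epsilon> + (b - a) * (measure (sample M n) (?L n) + measure (sample M n) (?U n))) \<longlonglongrightarrow> \<epsilon> + (b - a) * (0 + 0)"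
    by (intro tendsto_intros)
  then have "\<forall>\<^sub>F n in sequentially. \<epsilon> + (b - a) * (measure (sample M n) (?L n) + measure (sample M n) (?U n)) < e"
    by (rule order_tendstoD) (use e in \<open>simp add: \<epsilon>_def\<close>)
  then show "\<forall>\<^sub>F n in sequentially. (\<integral>x. \<bar>squantile n v x - q\<bar> \<partial>sample M n) < e"
    using eventually_ge_at_top[of 1]
  proof eventually_elim
    case (elim n)
    then have n: "n \<ge> 1" by simp
    interpret S: prob_space "sample M n" by (rule prob_space_sample)
    note [measurable] = squantile_measurable[OF n v]
    have "(\<integral>x. \<bar>squantile n v x - q\<bar> \<partial>sample M n) \<le> (\<integral>x. \<epsilon> + (b - a) * (indicator (?L n) x + indicator (?U n) x) \<partial>sample M n)"
    proof (rule integral_mono_AE)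
      show "integrable (sample M n) (\<lambda>x. \<bar>squantile n v x - q\<bar>)" by (rule integrable_squantile_dev[OF n v])
      show "integrable (sample M n) (\<lambda>x. \<epsilon> + (b - a) * (indicator (?L n) x + indicator (?U n) x))"
        by (intro Bochner_Integration.integrable_add integrable_mult_right S.integrable_indicat_sets) auto
      show "AE x in sample M n. \<bar>squantile n v x - q\<bar> \<le> \<epsilon> + (b - a) * (indicator (?L n) x + indicator (?U n) x)"
        using AE_squantile_bounds[OF n v] AE_space
        by eventually_elim (use q \<epsilon> a_le_b in \<open>auto simp: indicator_def\<close>)
    qed
    also have "\<dots> = \<epsilon> + (b - a) * (measure (sample M n) (?L n) + measure (sample M n) (?U n))"
    proof -
      have "integrable (sample M n) (indicat_real (?L n))" "integrable (sample M n) (indicat_real (?U n))"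
        by (auto intro!: S.integrable_indicat_sets)
      then show ?thesis using S.prob_space by (simp add: Int_absorb1)
    qed
    also note elim(1)
    finally show ?case .
  qed
qed

end

section \<open>Expected social cost\<close>

text \<open>Half-line indicators integrate to distribution functions, so this makes a facility cost
  linear in the cdf up to one mesh width. At \<open>x\<close> the approximation telescopes to the
  value of \<open>f\<close> at the first grid point not left of \<open>x\<close>.\<close>

lemma lipschitz_step_approx:
  fixes f :: "real \<Rightarrow> real" and n :: nat
  assumes lip: "\<And>x y. \<bar>f x - f y\<bar> \<le> \<bar>x - y\<bar>" and n: "n \<ge> 1" and x: "a \<le> x" "x \<le> b"
  defines "h \<equiv> (b - a) / real n"
  defines "t \<equiv> (\<lambda>i::nat. a + real i * h)"
  shows "\<bar>f x - (f b - (\<Sum>i<n. (f (t (Suc i)) - f (t i)) * indicator {..t i} x))\<bar> \<le> h"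
proof -
  have h: "0 \<le> h" using x by (simp add: h_def)
  have tn: "t n = b" using n by (simp add: t_def h_def)
  define l where "l = (LEAST i. x \<le> t i)"
  have xl: "x \<le> t l" unfolding l_def by (rule LeastI[of _ n]) (simp add: tn x)
  have ln: "l \<le> n" unfolding l_def by (rule Least_le) (simp add: tn x)
  have iff: "x \<le> t i \<longleftrightarrow> l \<le> i" for i
  proof
    assume "l \<le> i"
    then have "t l \<le> t i" using h by (auto simp: t_def intro: mult_right_mono)
    with xl show "x \<le> t i" by simp
  qed (simp add: l_def Least_le)
  have "(\<Sum>i<n. (f (t (Suc i)) - f (t i)) * indicator {..t i} x) = (\<Sum>i=l..<n. f (t (Suc i)) - f (t i))"
    by (rule sum.mono_neutral_cong_right) (auto simp: iff)
  also have "\<dots> = f b - f (t l)" using sum_Suc_diff'[OF ln, of "\<lambda>i. f (t i)"] tn by simp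
  finally have "\<bar>f x - (f b - (\<Sum>i<n. (f (t (Suc i)) - f (t i)) * indicator {..t i} x))\<bar> = \<bar>f x - f (t l)\<bar>"
    by simp
  also have "\<dots> \<le> \<bar>x - t l\<bar>" by (rule lip)
  also have "\<dots> \<le> h"
  proof (cases l)
    case 0
    then show ?thesis using xl x h by (simp add: t_def)
  next
    case (Suc m)
    then have "t m < x" using iff[of m] by simp
    then show ?thesis using xl Suc by (simp add: t_def algebra_simps)
  qed
  finally show ?thesis .
qed

lemma SC_nonneg: "k \<ge> 1 \<Longrightarrow> 0 \<le> SC n k x p"
  unfolding SC_eq_dmin by (intro divide_nonneg_nonneg sum_nonneg dmin_nonneg) auto

lemma SC_mono:
  assumes "k \<ge> 1" "n \<ge> 1" "\<And>i j. i < n \<Longrightarrow> j \<in> {1..k} \<Longrightarrow> \<bar>x i - p j\<bar> \<le> \<bar>x i - r j\<bar> + w"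
  shows "SC n k x p \<le> SC n k x r + w"
proof -
  have "(\<Sum>i<n. dmin k p (x i)) \<le> (\<Sum>i<n. dmin k r (x i) + w)"
    using assms by (intro sum_mono dmin_mono) auto
  then have "(\<Sum>i<n. dmin k p (x i)) / real n \<le> (\<Sum>i<n. dmin k r (x i) + w) / real n"
    by (rule divide_right_mono) simp
  then show ?thesis using assms(2) by (simp add: SC_eq_dmin sum.distrib add_divide_distrib)
qed

lemma SC_le_bounds:
  assumes "k \<ge> 1" "n \<ge> 1" "\<And>i. i < n \<Longrightarrow> a \<le> x i \<and> x i \<le> b" "\<And>j. j \<in> {1..k} \<Longrightarrow> a \<le> p j \<and> p j \<le> b"
  shows "SC n k x p \<le> b - a"
proof -
  have "(\<Sum>i<n. dmin k p (x i)) \<le> (\<Sum>i<n. b - a)"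
  proof (rule sum_mono)
    fix i assume "i \<in> {..<n}"
    then have "\<bar>x i - p 1\<bar> \<le> b - a" using assms(3)[of i] assms(4)[of 1] assms(1) by auto
    then show "dmin k p (x i) \<le> b - a" using dmin_le[of 1 k p "x i"] assms(1) by simp
  qed
  then have "(\<Sum>i<n. dmin k p (x i)) / real n \<le> (\<Sum>i<n. b - a) / real n"
    by (rule divide_right_mono) simp
  then show ?thesis using assms(2) by (simp add: SC_eq_dmin)
qed

lemma SC_opt_le: "k \<ge> 1 \<Longrightarrow> SC_opt n k x \<le> SC n k x p"
  unfolding SC_opt_def by (rule cINF_lower) (auto intro!: bdd_belowI2[where m = 0] SC_nonneg)

lemma SC_opt_ge: "(\<And>p. c \<le> SC n k x p) \<Longrightarrow> c \<le> SC_opt n k x"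
  unfolding SC_opt_def by (rule cINF_greatest) auto

text \<open>For measurability the infimum must run over countably many configurations; rational ones
  suffice by the Lipschitz bound. \<open>PiE\<close> fixes the values outside \<open>{1..k}\<close>,
  which keeps the family countable.\<close>

lemma SC_opt_less_iff:
  assumes k: "k \<ge> 1" and n: "n \<ge> 1"
  shows "SC_opt n k x < c \<longleftrightarrow> (\<exists>p\<in>PiE {1..k} (\<lambda>_. \<rat>). SC n k x p < c)"
proof
  assume "SC_opt n k x < c"
  then obtain p where p: "SC n k x p < c" using SC_opt_ge[of c n k x] by (meson not_le)
  define e where "e = (c - SC n k x p) / 2"
  have e: "e > 0" using p by (simp add: e_def)
  have "\<exists>r\<in>\<rat>. \<bar>p j - r\<bar> \<le> e" for j
  proof -
    obtain r where "r \<in> \<rat>" "p j - e < r" "r < p j" using Rats_dense_in_real[of "p j - e" "p j"] e by auto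
    then show ?thesis by (intro bexI[of _ r]) auto
  qed
  then obtain r where r: "\<And>j. r j \<in> \<rat>" "\<And>j. \<bar>p j - r j\<bar> \<le> e" by metis
  have "SC n k x (restrict r {1..k}) \<le> SC n k x p + e"
  proof (rule SC_mono[OF k n])
    fix i j assume "i < n" "j \<in> {1..k}"
    then show "\<bar>x i - restrict r {1..k} j\<bar> \<le> \<bar>x i - p j\<bar> + e" using r(2)[of j] by auto
  qed
  also have "\<dots> < c" using e by (simp add: e_def field_simps)
  finally show "\<exists>p\<in>PiE {1..k} (\<lambda>_. \<rat>). SC n k x p < c"
    using r(1) by (intro bexI[of _ "restrict r {1..k}"]) auto
qed (use SC_opt_le[OF k] in \<open>force intro: le_less_trans\<close>)

section \<open>Measurability of the sample costs\<close>

context real_distribution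
begin

lemma SC_measurable [measurable]: "(\<lambda>x. SC n k x p) \<in> borel_measurable (sample M n)"
  unfolding SC_eq_dmin by measurable

lemma SC_opt_measurable:
  assumes "k \<ge> 1" "n \<ge> 1"
  shows "SC_opt n k \<in> borel_measurable (sample M n)"
  unfolding borel_measurable_iff_less
proof
  fix c
  have "countable (PiE {1..k} (\<lambda>_. \<rat> :: real set))"
    by (intro countable_PiE) (auto simp: countable_rat)
  then have "(\<Union>p\<in>PiE {1..k} (\<lambda>_. \<rat>). {x \<in> space (sample M n). SC n k x p < c}) \<in> sets (sample M n)"
    by (rule sets.countable_UN'') measurable
  also have "(\<Union>p\<in>PiE {1..k} (\<lambda>_. \<rat>). {x \<in> space (sample M n). SC n k x p < c}) =
      {x \<in> space (sample M n). SC_opt n k x < c}"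
    unfolding SC_opt_less_iff[OF assms] by auto
  finally show "{x \<in> space (sample M n). SC_opt n k x < c} \<in> sets (sample M n)" .
qed

lemma SC_PM_measurable:
  assumes "n \<ge> 1" "\<And>j. 0 \<le> v j \<and> v j \<le> 1"
  shows "SC_PM n k v \<in> borel_measurable (sample M n)"
proof -
  have [measurable]: "squantile n (v j) \<in> borel_measurable (sample M n)" for j
    using assms by (intro squantile_measurable) auto
  show ?thesis
    unfolding SC_PM_def[abs_def] SC_def PM_eq_squantile
    by (intro borel_measurable_divide borel_measurable_sum borel_measurable_Min) measurable
qed

end

section \<open>Expected sample costs against the cost under the law\<close>

context bounded_distribution
begin

lemma integral_SC:
  assumes "k \<ge> 1" "n \<ge> 1"
  shows "integrable (sample M n) (\<lambda>x. SC n k x p)" "(\<integral>x. SC n k x p \<partial>sample M n) = cost M k p"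
proof -
  have i: "integrable (sample M n) (\<lambda>x. dmin k p (x i))" if "i < n" for i
    using that integrable_dmin[OF assms(1)] by (intro integrable_sample_coord) auto
  show "integrable (sample M n) (\<lambda>x. SC n k x p)"
    unfolding SC_eq_dmin using i by (intro integrable_divide Bochner_Integration.integrable_sum) auto
  have "(\<integral>x. SC n k x p \<partial>sample M n) = (\<Sum>i<n. \<integral>x. dmin k p (x i) \<partial>sample M n) / real n"
    unfolding SC_eq_dmin using i by (simp add: Bochner_Integration.integral_sum[of "{..<n}" "sample M n" "\<lambda>i x. dmin k p (x i)"])
  also have "(\<Sum>i<n. \<integral>x. dmin k p (x i) \<partial>sample M n) = (\<Sum>i<n. cost M k p)"
    unfolding cost_def by (intro sum.cong refl integral_sample_coord) auto
  finally show "(\<integral>x. SC n k x p \<partial>sample M n) = cost M k p" using assms by simp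
qed

text \<open>The error term does not involve \<open>p\<close>, so the bound survives the infimum over
  \<open>p\<close>. Replacing \<open>dmin k p\<close> by the step function \<open>g\<close> costs
  \<open>h\<close> under the law and \<open>h\<close> under the sample; what remains are differences
  of distribution functions at grid points, with weights at most \<open>h\<close>.\<close>

lemma cost_le_SC:
  assumes k: "k \<ge> 1" and n: "n \<ge> 1" and x: "\<And>i. i < n \<Longrightarrow> a \<le> x i \<and> x i \<le> b"
  defines "h \<equiv> (b - a) / real n"
  defines "t \<equiv> (\<lambda>i::nat. a + real i * h)"
  shows "cost M k p \<le> SC n k x p + 2 * h + h * (\<Sum>l<n. \<bar>ecount n x (t l) / real n - cdf M (t l)\<bar>)"
proof -
  let ?f = "dmin k p"
  define \<Delta> where "\<Delta> l = ?f (t (Suc l)) - ?f (t l)" for l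
  define g where "g z = ?f b - (\<Sum>l<n. \<Delta> l * indicator {..t l} z)" for z
  have h0: "0 \<le> h" using a_le_b by (simp add: h_def)
  have approx: "\<bar>?f z - g z\<bar> \<le> h" if "a \<le> z" "z \<le> b" for z
    using lipschitz_step_approx[of ?f n a z b] dmin_lipschitz[OF k] n that
    by (simp add: g_def \<Delta>_def t_def h_def)
  have \<Delta>: "\<bar>\<Delta> l\<bar> \<le> h" for l
  proof -
    have "\<bar>\<Delta> l\<bar> \<le> \<bar>t (Suc l) - t l\<bar>" unfolding \<Delta>_def by (rule dmin_lipschitz[OF k])
    also have "\<dots> = h" using h0 by (simp add: t_def algebra_simps)
    finally show ?thesis .
  qed
  have int_g: "integrable M g" unfolding g_def[abs_def]
    by (intro Bochner_Integration.integrable_diff Bochner_Integration.integrable_sum integrable_mult_right integrable_indicat_sets) auto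
  have g_int: "(\<integral>z. g z \<partial>M) = ?f b - (\<Sum>l<n. \<Delta> l * cdf M (t l))"
  proof -
    have i: "integrable M (\<lambda>z. \<Delta> l * indicator {..t l} z)" for l
      by (intro integrable_mult_right integrable_indicat_sets) auto
    have "integrable M (\<lambda>z. \<Sum>l<n. \<Delta> l * indicator {..t l} z)"
      using i by (rule Bochner_Integration.integrable_sum)
    then have "(\<integral>z. g z \<partial>M) = (\<integral>z. ?f b \<partial>M) - (\<integral>z. (\<Sum>l<n. \<Delta> l * indicator {..t l} z) \<partial>M)"
      unfolding g_def by (intro Bochner_Integration.integral_diff) auto
    also have "(\<integral>z. ?f b \<partial>M) = ?f b" using prob_space by simp
    also have "(\<integral>z. (\<Sum>l<n. \<Delta> l * indicator {..t l} z) \<partial>M) = (\<Sum>l<n. \<Delta> l * cdf M (t l))"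
      using i by (subst Bochner_Integration.integral_sum) (auto simp: cdf_def)
    finally show ?thesis .
  qed
  have "AE z in M. ?f z \<le> g z + h"
    using AE_bounds
  proof eventually_elim
    case (elim z)
    then show ?case using approx[of z] by linarith
  qed
  then have "cost M k p \<le> (\<integral>z. g z + h \<partial>M)"
    unfolding cost_def using integrable_dmin[OF k] int_g by (intro integral_mono_AE) auto
  also have "\<dots> = ?f b - (\<Sum>l<n. \<Delta> l * cdf M (t l)) + h"
    using int_g prob_space by (simp add: g_int)
  finally have 1: "cost M k p \<le> ?f b - (\<Sum>l<n. \<Delta> l * cdf M (t l)) + h" .
  have "(\<Sum>i<n. g (x i) - h) \<le> (\<Sum>i<n. ?f (x i))"
  proof (rule sum_mono)
    fix i assume "i \<in> {..<n}"
    then show "g (x i) - h \<le> ?f (x i)" using approx[of "x i"] x[of i] by auto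
  qed
  then have "(\<Sum>i<n. g (x i) - h) / real n \<le> SC n k x p"
    unfolding SC_eq_dmin by (rule divide_right_mono) simp
  moreover have "(\<Sum>i<n. g (x i) - h) / real n = ?f b - (\<Sum>l<n. \<Delta> l * (ecount n x (t l) / real n)) - h"
  proof -
    have "(\<Sum>i<n. \<Sum>l<n. \<Delta> l * indicator {..t l} (x i)) = (\<Sum>l<n. \<Delta> l * ecount n x (t l))"
      unfolding ecount_def sum_distrib_left by (rule sum.swap)
    then have "(\<Sum>i<n. g (x i) - h) = real n * ?f b - (\<Sum>l<n. \<Delta> l * ecount n x (t l)) - real n * h"
      by (simp add: g_def sum_subtractf)
    then show ?thesis using n by (simp add: diff_divide_distrib sum_divide_distrib)
  qed
  moreover have "(\<Sum>l<n. \<Delta> l * (ecount n x (t l) / real n)) - (\<Sum>l<n. \<Delta> l * cdf M (t l)) \<le>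
      h * (\<Sum>l<n. \<bar>ecount n x (t l) / real n - cdf M (t l)\<bar>)"
  proof -
    have "(\<Sum>l<n. \<Delta> l * (ecount n x (t l) / real n)) - (\<Sum>l<n. \<Delta> l * cdf M (t l)) =
        (\<Sum>l<n. \<Delta> l * (ecount n x (t l) / real n - cdf M (t l)))"
      by (simp add: sum_subtractf[symmetric] right_diff_distrib)
    also have "\<dots> \<le> (\<Sum>l<n. h * \<bar>ecount n x (t l) / real n - cdf M (t l)\<bar>)"
    proof (rule sum_mono)
      fix l
      have "\<Delta> l * (ecount n x (t l) / real n - cdf M (t l)) \<le> \<bar>\<Delta> l\<bar> * \<bar>ecount n x (t l) / real n - cdf M (t l)\<bar>"
        by (metis abs_ge_self abs_mult)
      also have "\<dots> \<le> h * \<bar>ecount n x (t l) / real n - cdf M (t l)\<bar>"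
        by (intro mult_right_mono \<Delta>) simp
      finally show "\<Delta> l * (ecount n x (t l) / real n - cdf M (t l)) \<le> h * \<bar>ecount n x (t l) / real n - cdf M (t l)\<bar>" .
    qed
    finally show ?thesis by (simp add: sum_distrib_left)
  qed
  ultimately show ?thesis using 1 by linarith
qed

lemma integrable_SC_opt:
  assumes k: "k \<ge> 1" and n: "n \<ge> 1"
  shows "integrable (sample M n) (SC_opt n k)"
proof -
  interpret S: prob_space "sample M n" by (rule prob_space_sample)
  show ?thesis
  proof (rule S.integrable_const_bound[where B = "b - a"])
    show "AE x in sample M n. norm (SC_opt n k x) \<le> b - a"
      using AE_sample_bounds
    proof eventually_elim
      case (elim x)
      have "SC_opt n k x \<le> SC n k x (\<lambda>_. a)" by (rule SC_opt_le[OF k])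
      also have "\<dots> \<le> b - a" using elim a_le_b by (intro SC_le_bounds[OF k n]) auto
      finally show ?case using SC_opt_ge[of 0 n k x] SC_nonneg[OF k] by simp
    qed
  qed (rule SC_opt_measurable[OF k n])
qed

text \<open>An expected minimum is at most the expectation at any fixed configuration.\<close>

lemma expected_SC_opt_le:
  assumes k: "k \<ge> 1" and n: "n \<ge> 1"
  shows "(\<integral>x. SC_opt n k x \<partial>sample M n) \<le> cost M k p"
proof -
  have "(\<integral>x. SC_opt n k x \<partial>sample M n) \<le> (\<integral>x. SC n k x p \<partial>sample M n)"
    using integrable_SC_opt[OF k n] integral_SC(1)[OF k n] SC_opt_le[OF k] by (intro integral_mono) auto
  then show ?thesis by (simp add: integral_SC(2)[OF k n])
qed

text \<open>The \<open>n\<close> grid points, each of weight \<open>h\<close>, contribute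
  \<open>(b - a) / sqrt n\<close> in the mean; the discretisation error \<open>2 * h\<close> is at
  most twice that. Hence the factor 3.\<close>

lemma expected_SC_opt_ge:
  assumes k: "k \<ge> 1" and n: "n \<ge> 1" and w: "\<And>p. w \<le> cost M k p"
  shows "w - 3 * (b - a) / sqrt (real n) \<le> (\<integral>x. SC_opt n k x \<partial>sample M n)"
proof -
  interpret S: prob_space "sample M n" by (rule prob_space_sample)
  define h where "h = (b - a) / real n"
  define t where "t = (\<lambda>i::nat. a + real i * h)"
  let ?D = "\<lambda>l x. \<bar>ecount n x (t l) / real n - cdf M (t l)\<bar>"
  have h0: "0 \<le> h" using a_le_b by (simp add: h_def)
  note D = ecount_mean_deviation[OF n]
  have int: "integrable (sample M n) (\<lambda>x. w - (2 * h + h * (\<Sum>l<n. ?D l x)))"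
    using D(1) by (intro Bochner_Integration.integrable_diff Bochner_Integration.integrable_add
        integrable_mult_right Bochner_Integration.integrable_sum) auto
  have "w - (2 * h + h * (\<Sum>l<n. 1 / sqrt (real n))) \<le> w - (2 * h + h * (\<Sum>l<n. \<integral>x. ?D l x \<partial>sample M n))"
    using h0 D(2) by (intro diff_left_mono add_left_mono mult_left_mono sum_mono) auto
  also have "\<dots> = (\<integral>x. w - (2 * h + h * (\<Sum>l<n. ?D l x)) \<partial>sample M n)"
  proof -
    have "(\<Sum>l<n. \<integral>x. ?D l x \<partial>sample M n) = (\<integral>x. (\<Sum>l<n. ?D l x) \<partial>sample M n)"
      using D(1) by (subst Bochner_Integration.integral_sum) auto
    moreover have "integrable (sample M n) (\<lambda>x. \<Sum>l<n. ?D l x)"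
      using D(1) by (intro Bochner_Integration.integrable_sum)
    ultimately show ?thesis using S.prob_space by simp
  qed
  also have "\<dots> \<le> (\<integral>x. SC_opt n k x \<partial>sample M n)"
  proof (intro integral_mono_AE int integrable_SC_opt[OF k n])
    show "AE x in sample M n. w - (2 * h + h * (\<Sum>l<n. ?D l x)) \<le> SC_opt n k x"
      using AE_sample_bounds
    proof eventually_elim
      case (elim x)
      show ?case
      proof (rule SC_opt_ge)
        fix p
        show "w - (2 * h + h * (\<Sum>l<n. ?D l x)) \<le> SC n k x p"
          using cost_le_SC[OF k n, of x p] elim w[of p] by (simp add: h_def t_def)
      qed
    qed
  qed
  finally have "w - (2 * h + h * (real n / sqrt (real n))) \<le> (\<integral>x. SC_opt n k x \<partial>sample M n)"
    by simp
  moreover have "h \<le> (b - a) / sqrt (real n)"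
  proof -
    have "sqrt (real n) \<le> real n" using n by (intro real_le_lsqrt) (auto simp: power2_eq_square)
    then show ?thesis unfolding h_def using a_le_b n by (intro divide_left_mono) auto
  qed
  moreover have "h * (real n / sqrt (real n)) = (b - a) / sqrt (real n)"
    using n by (simp add: h_def)
  moreover have "3 * (b - a) / sqrt (real n) = 3 * ((b - a) / sqrt (real n))" by simp
  ultimately show ?thesis by linarith
qed

lemma integrable_SC_PM:
  assumes k: "k \<ge> 1" and n: "n \<ge> 1" and v: "\<And>j. 0 \<le> v j \<and> v j \<le> 1"
  shows "integrable (sample M n) (SC_PM n k v)"
proof -
  interpret S: prob_space "sample M n" by (rule prob_space_sample)
  show ?thesis
  proof (rule S.integrable_const_bound[where B = "b - a"])
    show "AE x in sample M n. norm (SC_PM n k v x) \<le> b - a"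
      using AE_sample_bounds
    proof eventually_elim
      case (elim x)
      have "a \<le> PM n v x j \<and> PM n v x j \<le> b" for j
        unfolding PM_eq_squantile using elim v[of j] squantile_bounds[OF n, of "v j" a x b] by blast
      with elim have "SC n k x (PM n v x) \<le> b - a"
        by (intro SC_le_bounds[OF k n]) auto
      then show ?case using SC_nonneg[OF k] by (simp add: SC_PM_def)
    qed
  qed (rule SC_PM_measurable[OF n v])
qed

lemma expected_SC_opt_le_SC_PM:
  assumes k: "k \<ge> 1" and n: "n \<ge> 1" and v: "\<And>j. 0 \<le> v j \<and> v j \<le> 1"
  shows "(\<integral>x. SC_opt n k x \<partial>sample M n) \<le> (\<integral>x. SC_PM n k v x \<partial>sample M n)"
proof (rule integral_mono)
  show "integrable (sample M n) (SC_opt n k)" by (rule integrable_SC_opt[OF k n])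
  show "integrable (sample M n) (SC_PM n k v)" by (rule integrable_SC_PM[OF k n v])
qed (simp add: SC_PM_def SC_opt_le[OF k])

end

section \<open>Distributions with regular quantiles\<close>

text \<open>The consequences of the standing assumptions that are used from here on;
  \<open>a\<close> and \<open>b\<close> are now the ends of the support. The constant in
  \<open>cdf_expanding\<close> depends on \<open>q\<close> and may grow without bound towards the
  ends, where the density may vanish.\<close>

locale regular_distribution = bounded_distribution +
  assumes atomless: "measure M {x} = 0"
    and cdf_strict: "a \<le> s \<Longrightarrow> s < t \<Longrightarrow> t \<le> b \<Longrightarrow> cdf M s < cdf M t"
    and cdf_expanding: "a < q \<Longrightarrow> q < b \<Longrightarrow>
      \<exists>K>0. \<forall>x. a \<le> x \<longrightarrow> x \<le> b \<longrightarrow> \<bar>x - q\<bar> \<le> K * \<bar>cdf M x - cdf M q\<bar>"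
begin

lemma AE_not_finite: "finite F \<Longrightarrow> AE x in M. x \<notin> F"
proof -
  assume "finite F"
  then have "(\<Union>x\<in>F. {x}) \<in> null_sets M"
    using atomless by (intro null_sets_UN') (auto simp: null_sets_def emeasure_eq_measure countable_finite)
  then show ?thesis by (intro AE_not_in) simp
qed

lemma cdf_a: "cdf M a = 0"
proof -
  have "AE x in M. x \<notin> {..a}"
    using AE_bounds AE_not_finite[of "{a}", simplified] by eventually_elim auto
  then show ?thesis unfolding cdf_def by (subst prob_eq_0) auto
qed

lemma cdf_b: "cdf M b = 1"
proof -
  have "AE x in M. x \<in> {..b}" using AE_bounds by eventually_elim auto
  then show ?thesis unfolding cdf_def by (subst prob_eq_1) auto
qed

lemma quantile_ex:
  assumes "0 \<le> v" "v \<le> 1"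
  shows "\<exists>q. a \<le> q \<and> q \<le> b \<and> cdf M q = v"
proof (rule IVT')
  show "continuous_on {a..b} (cdf M)"
    using isCont_cdf atomless by (intro continuous_at_imp_continuous_on) simp
qed (use assms cdf_a cdf_b a_le_b in auto)

text \<open>By strict monotonicity \<open>q\<close> is the leftmost point of its level. Level 0 is
  excluded because the cdf also vanishes left of \<open>a\<close>.\<close>

lemma quantile_le:
  assumes "a \<le> q" "q \<le> b" "0 < cdf M q" "cdf M q \<le> cdf M s"
  shows "q \<le> s"
proof (rule ccontr)
  assume "\<not> q \<le> s"
  then have "s < q" by simp
  moreover have "a \<le> s"
  proof (rule ccontr)
    assume "\<not> a \<le> s"
    then have "cdf M s \<le> cdf M a" by (intro cdf_nondecreasing) simp
    with assms cdf_a show False by simp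
  qed
  ultimately show False using cdf_strict[of s q] assms by simp
qed

text \<open>\<open>dmin\<close> vanishes only at the finitely many facilities, which form a null
  set. This keeps the limiting denominators away from 0.\<close>

lemma cost_pos:
  assumes k: "k \<ge> 1"
  shows "0 < cost M k p"
proof -
  have "cost M k p \<noteq> 0"
  proof
    assume "cost M k p = 0"
    then have "AE x in M. dmin k p x = 0"
      unfolding cost_def using integrable_dmin[OF k] dmin_nonneg[OF k]
      by (subst (asm) integral_nonneg_eq_0_iff_AE) auto
    moreover have "AE x in M. x \<notin> p ` {1..k}" by (rule AE_not_finite) simp
    ultimately have "AE x in M. False"
    proof eventually_elim
      case (elim x)
      obtain j where "j \<in> {1..k}" "dmin k p x = \<bar>x - p j\<bar>" using dmin_attained[OF k] .
      with elim show False by auto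
    qed
    then show False by simp
  qed
  with cost_nonneg[OF k, of p] show ?thesis by simp
qed

text \<open>Sample quantiles converge to the quantiles \<open>q\<close> inside the support, while
  \<open>y\<close> is not assumed to lie there; passing from \<open>y\<close> to \<open>q\<close>
  crosses only null gaps.\<close>

lemma cost_own_quantiles_le:
  assumes k: "k \<ge> 1" and opt: "\<And>r. cost M k y \<le> cost M k r"
    and q: "\<And>j. a \<le> q j \<and> q j \<le> b \<and> cdf M (q j) = cdf M (y j)"
  shows "cost M k q \<le> cost M k y"
proof (rule cost_shift[OF k opt])
  fix j
  show "cdf M (y j) = 0 \<or> q j \<le> y j \<and> cdf M (q j) = cdf M (y j)"
    using q[of j] quantile_le[of "q j" "y j"] cdf_nonneg[of "y j"] by force
qed

text \<open>\<open>N\<close> is the law from which the levels come, \<open>M\<close> the true law.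
  The final chain spends \<open>w\<close> on passing from \<open>q\<close> to \<open>z\<close> and
  one \<open>W1\<close> on each change of law.\<close>

lemma cost_quantiles_le:
  assumes k: "k \<ge> 1" and M: "bounded_distribution M c d" and N: "bounded_distribution N c d"
    and opt: "\<And>r. cost N k y \<le> cost N k r"
    and q: "\<And>j. a \<le> q j \<and> q j \<le> b \<and> cdf M (q j) = cdf N (y j)"
  shows "cost M k q \<le> cost M k p + (Winf M N + 2 * W1 M N)"
proof (rule field_le_epsilon)
  interpret N: bounded_distribution N c d by fact
  fix e :: real assume e: "e > 0"
  define w where "w = Winf M N + e"
  obtain \<pi> where \<pi>: "\<pi> \<in> couplings M N" "AE z in \<pi>. \<bar>fst z - snd z\<bar> \<le> w" "0 \<le> Winf M N"
    unfolding w_def by (rule Winf_coupling[OF M N e])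
  have w: "w \<ge> 0" using \<pi>(3) e by (simp add: w_def)
  note shift = cdf_coupling_shift[OF real_distribution_axioms N.real_distribution_axioms \<pi>(1,2)]
  \<comment> \<open>If \<open>cdf N (y j) = 0\<close>, the cell of \<open>y j\<close> is a null set and that facility may be put anywhere.\<close>
  define z where "z j = (if cdf N (y j) = 0 then q j else min (y j) (q j + w))" for j
  have "cost N k z \<le> cost N k y"
  proof (rule N.cost_shift[OF k opt])
    fix j
    show "cdf N (y j) = 0 \<or> z j \<le> y j \<and> cdf N (z j) = cdf N (y j)"
    proof (cases "cdf N (y j) = 0 \<or> y j \<le> q j + w")
      case True
      then show ?thesis by (auto simp: z_def)
    next
      case False
      \<comment> \<open>The coupling gives \<open>N\<close> at least as much mass up to
        \<open>q j + w\<close> as \<open>M\<close> has up to \<open>q j\<close>, so \<open>N\<close>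
        has none between \<open>z j\<close> and \<open>y j\<close>.\<close>
      then have z: "z j = q j + w" "z j \<le> y j" by (auto simp: z_def)
      have "cdf N (y j) \<le> cdf N (z j)" using shift(1)[of "q j"] q[of j] z by simp
      with N.cdf_nondecreasing[OF z(2)] z(2) show ?thesis by simp
    qed
  qed
  have zq: "\<bar>q j - z j\<bar> \<le> w" for j
  proof (cases "cdf N (y j) = 0")
    case True
    then show ?thesis using w by (simp add: z_def)
  next
    case False
    then have "0 < cdf N (y j)" using N.cdf_nonneg[of "y j"] by simp
    \<comment> \<open>The reverse shift: the level of \<open>q j\<close> is reached by
      \<open>M\<close> at \<open>y j + w\<close>, and \<open>q j\<close> is leftmost in its
      level.\<close>
    then have "q j \<le> y j + w" using q[of j] shift(2)[of "y j"] quantile_le[of "q j" "y j + w"] by simp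
    then show ?thesis using False w by (auto simp: z_def)
  qed
  have "cost M k q \<le> cost M k z + w"
  proof (rule cost_le[OF k], intro AE_I2)
    fix x
    show "dmin k q x \<le> dmin k z x + w"
    proof (rule dmin_mono[OF k])
      fix j
      show "\<bar>x - q j\<bar> \<le> \<bar>x - z j\<bar> + w" using zq[of j] by linarith
    qed
  qed
  also have "cost M k z \<le> cost N k z + W1 M N" by (rule cost_le_cost_plus_W1[OF M N k])
  also have "cost N k z \<le> cost N k y" by fact
  also have "cost N k y \<le> cost N k p" by (rule opt)
  also have "cost N k p \<le> cost M k p + W1 M N"
    using cost_le_cost_plus_W1[OF N M k, of p] W1_commute[of M N] by simp
  finally show "cost M k q \<le> cost M k p + (Winf M N + 2 * W1 M N) + e" by (simp add: w_def)
qed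

section \<open>Asymptotics of the expected costs and of their ratio\<close>

text \<open>Replacing the sample quantiles by the fixed points \<open>q\<close> changes the social
  cost by at most the sum of their deviations, which vanishes in the mean; at fixed points the
  expected cost is exactly \<open>cost M k q\<close>.\<close>

lemma SC_PM_expected_tendsto:
  assumes k: "k \<ge> 1" and v: "\<And>j. 0 \<le> v j \<and> v j \<le> 1"
    and q: "\<And>j. a \<le> q j \<and> q j \<le> b \<and> cdf M (q j) = v j"
  shows "(\<lambda>n. \<integral>x. SC_PM n k v x \<partial>sample M n) \<longlonglongrightarrow> cost M k q"
proof (rule LIM_zero_cancel, rule tendsto_rabs_zero_cancel, rule tendsto_sandwich[OF _ _ tendsto_const])
  have "(\<lambda>n. \<Sum>j=1..k. \<integral>x. \<bar>squantile n (v j) x - q j\<bar> \<partial>sample M n) \<longlonglongrightarrow> (\<Sum>j=1..k. 0)"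
    using v q by (intro tendsto_sum squantile_expected_dev_tendsto cdf_strict) auto
  then show "(\<lambda>n. \<Sum>j=1..k. \<integral>x. \<bar>squantile n (v j) x - q j\<bar> \<partial>sample M n) \<longlonglongrightarrow> 0" by simp
  show "\<forall>\<^sub>F n in sequentially. \<bar>(\<integral>x. SC_PM n k v x \<partial>sample M n) - cost M k q\<bar> \<le>
      (\<Sum>j=1..k. \<integral>x. \<bar>squantile n (v j) x - q j\<bar> \<partial>sample M n)"
  proof (rule eventually_sequentiallyI[of 1])
    fix n :: nat assume n: "n \<ge> 1"
    let ?D = "\<lambda>x. \<Sum>j=1..k. \<bar>squantile n (v j) x - q j\<bar>"
    have i: "integrable (sample M n) (\<lambda>x. \<bar>squantile n (v j) x - q j\<bar>)" for j
      using v n by (intro integrable_squantile_dev) auto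
    have pt: "\<bar>SC_PM n k v x - SC n k x q\<bar> \<le> ?D x" for x
    proof -
      have D: "\<bar>squantile n (v j) x - q j\<bar> \<le> ?D x" if "j \<in> {1..k}" for j
        using that by (intro member_le_sum) auto
      have "\<bar>x i - PM n v x j\<bar> \<le> \<bar>x i - q j\<bar> + ?D x" "\<bar>x i - q j\<bar> \<le> \<bar>x i - PM n v x j\<bar> + ?D x"
        if "j \<in> {1..k}" for i j
        unfolding PM_eq_squantile using D[OF that] by linarith+
      then have "SC_PM n k v x \<le> SC n k x q + ?D x" "SC n k x q \<le> SC_PM n k v x + ?D x"
        unfolding SC_PM_def by (intro SC_mono[OF k n]; simp)+
      then show ?thesis by linarith
    qed
    have "\<bar>(\<integral>x. SC_PM n k v x \<partial>sample M n) - cost M k q\<bar> = \<bar>\<integral>x. SC_PM n k v x - SC n k x q \<partial>sample M n\<bar>"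
      using integrable_SC_PM[OF k n v] integral_SC[OF k n, of q] by simp
    also have "\<dots> \<le> (\<integral>x. \<bar>SC_PM n k v x - SC n k x q\<bar> \<partial>sample M n)"
      by (rule integral_abs_bound)
    also have "\<dots> \<le> (\<integral>x. ?D x \<partial>sample M n)"
      using integrable_SC_PM[OF k n v] integral_SC(1)[OF k n, of q] i pt
      by (intro integral_mono) auto
    also have "\<dots> = (\<Sum>j=1..k. \<integral>x. \<bar>squantile n (v j) x - q j\<bar> \<partial>sample M n)"
      using i by (rule Bochner_Integration.integral_sum)
    finally show "\<bar>(\<integral>x. SC_PM n k v x \<partial>sample M n) - cost M k q\<bar> \<le> (\<Sum>j=1..k. \<integral>x. \<bar>squantile n (v j) x - q j\<bar> \<partial>sample M n)" .
  qed
qed simp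

text \<open>Only an upper bound is claimed, so the levels 0 and 1 need no rate: there
  \<open>q j\<close> is an end of the support, and the sample extreme lies between it and every
  report.\<close>

lemma SC_PM_expected_rate:
  assumes k: "k \<ge> 1" and v: "\<And>j. 0 \<le> v j \<and> v j \<le> 1"
    and q: "\<And>j. a \<le> q j \<and> q j \<le> b \<and> cdf M (q j) = v j"
  shows "\<exists>C\<ge>0. \<forall>n\<ge>1. (\<integral>x. SC_PM n k v x \<partial>sample M n) \<le> cost M k q + C / sqrt (real n)"
proof -
  define I where "I = {j \<in> {1..k}. 0 < v j \<and> v j < 1}"
  have "\<exists>K>0. \<forall>x. a \<le> x \<longrightarrow> x \<le> b \<longrightarrow> \<bar>x - q j\<bar> \<le> K * \<bar>cdf M x - v j\<bar>" if "j \<in> I" for j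
  proof -
    have "q j \<noteq> a" "q j \<noteq> b" using that q[of j] cdf_a cdf_b by (auto simp: I_def)
    then show ?thesis using cdf_expanding[of "q j"] q[of j] by auto
  qed
  then obtain K where K: "\<And>j. j \<in> I \<Longrightarrow> K j > 0"
    "\<And>j x. j \<in> I \<Longrightarrow> a \<le> x \<Longrightarrow> x \<le> b \<Longrightarrow> \<bar>x - q j\<bar> \<le> K j * \<bar>cdf M x - v j\<bar>" by metis
  define C where "C = (\<Sum>j\<in>I. 17 * K j)"
  have fin: "finite I" by (simp add: I_def)
  have "(\<integral>x. SC_PM n k v x \<partial>sample M n) \<le> cost M k q + C / sqrt (real n)" if n: "n \<ge> 1" for n
  proof -
    let ?D = "\<lambda>x. \<Sum>j\<in>I. \<bar>squantile n (v j) x - q j\<bar>"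
    have i: "integrable (sample M n) (\<lambda>x. \<bar>squantile n (v j) x - q j\<bar>)" for j
      using v n by (intro integrable_squantile_dev) auto
    have "AE x in sample M n. SC_PM n k v x \<le> SC n k x q + ?D x"
      using AE_sample_bounds
    proof eventually_elim
      case (elim x)
      have D0: "0 \<le> ?D x" by (intro sum_nonneg) auto
      show ?case unfolding SC_PM_def
      proof (rule SC_mono[OF k n])
        fix i j assume ij: "i < n" "j \<in> {1..k}"
        have xi: "a \<le> x i" "x i \<le> b" using elim ij by auto
        have b: "a \<le> squantile n (v j) x" "squantile n (v j) x \<le> b"
          using squantile_bounds[OF n, of "v j" a x b] v[of j] elim by blast+
        consider "j \<in> I" | "v j = 0" | "v j = 1" using v[of j] ij by (force simp: I_def)
        then show "\<bar>x i - PM n v x j\<bar> \<le> \<bar>x i - q j\<bar> + ?D x"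
        proof cases
          case 1
          then have "\<bar>squantile n (v j) x - q j\<bar> \<le> ?D x" using fin by (intro member_le_sum) auto
          then show ?thesis by (simp add: PM_eq_squantile)
        next
          case 2
          then have "q j = a" using cdf_strict[of a "q j"] q[of j] cdf_a by force
          then have "\<bar>x i - PM n v x j\<bar> \<le> \<bar>x i - q j\<bar>"
            using squantile_zero_le[OF ij(1), of x] 2 b xi by (simp add: PM_eq_squantile)
          with D0 show ?thesis by linarith
        next
          case 3
          then have "q j = b" using cdf_strict[of "q j" b] q[of j] cdf_b by force
          then have "\<bar>x i - PM n v x j\<bar> \<le> \<bar>x i - q j\<bar>"
            using squantile_one_ge[OF ij(1), of x] 3 b xi by (simp add: PM_eq_squantile)
          with D0 show ?thesis by linarith
        qed
      qed
    qed
    then have "(\<integral>x. SC_PM n k v x \<partial>sample M n) \<le> (\<integral>x. SC n k x q + ?D x \<partial>sample M n)"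
      using integrable_SC_PM[OF k n v] integral_SC(1)[OF k n, of q] i
      by (intro integral_mono_AE) auto
    also have "\<dots> = cost M k q + (\<Sum>j\<in>I. \<integral>x. \<bar>squantile n (v j) x - q j\<bar> \<partial>sample M n)"
      using integral_SC[OF k n, of q] i
      by (subst Bochner_Integration.integral_add) (auto intro!: Bochner_Integration.integral_sum)
    also have "\<dots> \<le> cost M k q + (\<Sum>j\<in>I. 17 * K j / sqrt (real n))"
      using K v q n by (intro add_left_mono sum_mono squantile_expected_dev_rate) auto
    finally show ?thesis by (simp add: C_def sum_divide_distrib)
  qed
  moreover have "0 \<le> C" unfolding C_def using K(1) by (intro sum_nonneg) (auto intro: less_imp_le)
  ultimately show ?thesis by blast
qed

lemma SC_opt_expected_tendsto:
  assumes k: "k \<ge> 1" and opt: "\<And>r. cost M k y \<le> cost M k r"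
  shows "(\<lambda>n. \<integral>x. SC_opt n k x \<partial>sample M n) \<longlonglongrightarrow> cost M k y"
proof (rule tendsto_sandwich[OF _ _ _ tendsto_const])
  have "(\<lambda>n. cost M k y - 3 * (b - a) * inverse (sqrt (real n))) \<longlonglongrightarrow> cost M k y - 3 * (b - a) * 0"
    by (intro tendsto_intros tendsto_inverse_0_at_top filterlim_compose[OF sqrt_at_top] filterlim_real_sequentially)
  then show "(\<lambda>n. cost M k y - 3 * (b - a) / sqrt (real n)) \<longlonglongrightarrow> cost M k y"
    by (simp add: divide_inverse)
  show "\<forall>\<^sub>F n in sequentially. cost M k y - 3 * (b - a) / sqrt (real n) \<le> (\<integral>x. SC_opt n k x \<partial>sample M n)"
    using expected_SC_opt_ge[OF k _ opt] by (intro eventually_sequentiallyI[of 1]) auto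
  show "\<forall>\<^sub>F n in sequentially. (\<integral>x. SC_opt n k x \<partial>sample M n) \<le> cost M k y"
    using expected_SC_opt_le[OF k] by (intro eventually_sequentiallyI[of 1]) auto
qed

lemma Bar_tendsto:
  assumes k: "k \<ge> 1" and opt: "\<And>r. cost M k y \<le> cost M k r"
    and v: "\<And>j. 0 \<le> v j \<and> v j \<le> 1" and q: "\<And>j. a \<le> q j \<and> q j \<le> b \<and> cdf M (q j) = v j"
  shows "(\<lambda>n. Bar n k M v) \<longlonglongrightarrow> cost M k q / cost M k y"
  unfolding Bar_def using cost_pos[OF k, of y]
  by (intro tendsto_divide SC_PM_expected_tendsto[OF k v q] SC_opt_expected_tendsto[OF k opt]) auto

text \<open>Positivity of the denominator is taken from its limit, hence only for large
  \<open>n\<close>. For \<open>n \<le> k\<close> the optimum is 0 and the quotient is 0 by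
  convention.\<close>

lemma Bar_ge_1:
  assumes k: "k \<ge> 1" and opt: "\<And>r. cost M k y \<le> cost M k r" and v: "\<And>j. 0 \<le> v j \<and> v j \<le> 1"
  shows "\<forall>\<^sub>F n in sequentially. 1 \<le> Bar n k M v"
  using order_tendstoD(1)[OF SC_opt_expected_tendsto[OF k opt] cost_pos[OF k]] eventually_ge_at_top[of 1]
proof eventually_elim
  case (elim n)
  then show ?case using expected_SC_opt_le_SC_PM[OF k elim(2) v] by (simp add: Bar_def)
qed

text \<open>Once the denominator exceeds half of its limit \<open>w\<close>, dividing by it instead
  of by \<open>w\<close> costs only a term of order \<open>1 / sqrt n\<close>.\<close>

lemma Bar_rate:
  assumes k: "k \<ge> 1" and opt: "\<And>r. cost M k y \<le> cost M k r"
    and v: "\<And>j. 0 \<le> v j \<and> v j \<le> 1" and q: "\<And>j. a \<le> q j \<and> q j \<le> b \<and> cdf M (q j) = v j"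
  shows "\<exists>C. \<forall>\<^sub>F n in sequentially. Bar n k M v - 1 \<le> (cost M k q - cost M k y) / cost M k y + C / sqrt (real n)"
proof -
  define w where "w = cost M k y"
  define D where "D = cost M k q - w"
  have w: "w > 0" unfolding w_def by (rule cost_pos[OF k])
  have D: "D \<ge> 0" using opt[of q] by (simp add: D_def w_def)
  obtain C2 where C2: "C2 \<ge> 0" "\<And>n. n \<ge> 1 \<Longrightarrow> (\<integral>x. SC_PM n k v x \<partial>sample M n) \<le> cost M k q + C2 / sqrt (real n)"
    using SC_PM_expected_rate[of k v q, OF k v q] by blast
  define C1 where "C1 = 3 * (b - a)"
  have C1: "C1 \<ge> 0" using a_le_b by (simp add: C1_def)
  have "\<forall>\<^sub>F n in sequentially. w / 2 < (\<integral>x. SC_opt n k x \<partial>sample M n)"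
    using order_tendstoD(1)[OF SC_opt_expected_tendsto[OF k opt], of "w / 2"] w by (simp add: w_def)
  then have "\<forall>\<^sub>F n in sequentially. Bar n k M v - 1 \<le> D / w + (2 * D * C1 / w\<^sup>2 + 2 * (C1 + C2) / w) / sqrt (real n)"
    using eventually_ge_at_top[of 1]
  proof eventually_elim
    case (elim n)
    let ?S = "\<integral>x. SC_PM n k v x \<partial>sample M n"
    let ?O = "\<integral>x. SC_opt n k x \<partial>sample M n"
    define s where "s = 1 / sqrt (real n)"
    have s: "s > 0" using elim by (simp add: s_def)
    have O: "?O > w / 2" "?O > 0" "w - C1 * s \<le> ?O"
      using elim w expected_SC_opt_ge[OF k elim(2) opt] by (auto simp: C1_def w_def s_def)
    have S: "?S \<le> D + w + C2 * s" using C2(2)[OF elim(2)] by (simp add: D_def s_def)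
    have "Bar n k M v - 1 = (?S - ?O) / ?O" using O by (simp add: Bar_def field_simps)
    also have "\<dots> \<le> (D + (C1 + C2) * s) / ?O"
      using S O by (intro divide_right_mono) (auto simp: algebra_simps)
    also have "\<dots> = D / ?O + (C1 + C2) * s / ?O" by (simp add: add_divide_distrib)
    \<comment> \<open>The exact correction for putting \<open>w\<close> in the denominator; it is of
      order \<open>s\<close> because \<open>w - ?O \<le> C1 * s\<close>.\<close>
    also have "D / ?O = D / w + D * (w - ?O) / (w * ?O)"
      using O w by (simp add: field_simps)
    also have "D * (w - ?O) / (w * ?O) \<le> D * (C1 * s) / (w * (w / 2))"
      using O w D C1 s by (intro frac_le mult_left_mono mult_nonneg_nonneg mult_pos_pos) auto
    also have "(C1 + C2) * s / ?O \<le> (C1 + C2) * s / (w / 2)"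
      using O w C1 C2 s by (intro divide_left_mono mult_nonneg_nonneg mult_pos_pos) auto
    finally have "Bar n k M v - 1 \<le> D / w + D * (C1 * s) / (w * (w / 2)) + (C1 + C2) * s / (w / 2)"
      by simp
    also have "\<dots> = D / w + (2 * D * C1 / w\<^sup>2 + 2 * (C1 + C2) / w) * s"
      using w by (simp add: field_simps power2_eq_square)
    finally show ?case by (simp add: s_def)
  qed
  then show ?thesis unfolding D_def w_def by blast
qed

end

section \<open>From the standing assumptions to regular quantiles\<close>

lemma sptD: "z \<in> spt M \<Longrightarrow> open U \<Longrightarrow> z \<in> U \<Longrightarrow> emeasure M U > 0"
  by (simp add: spt_def)

lemma closed_spt: "closed (spt M)"
proof -
  have "- spt M = \<Union>{U. open U \<and> \<not> emeasure M U > 0}" by (auto simp: spt_def)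
  then show ?thesis unfolding closed_def by auto
qed

text \<open>The new bounds are the ends of the support. Near an interior point continuity keeps the
  density above a positive constant, which gives the expansion of the cdf there.\<close>

lemma standing_regular:
  assumes st: "standing \<mu> \<rho>" and ab: "bounded_distribution \<mu> a b"
  obtains c d where "regular_distribution \<mu> c d"
proof -
  interpret bounded_distribution \<mu> a b by fact
  have \<rho> [measurable]: "\<rho> \<in> borel_measurable borel" and \<rho>0: "\<And>x. \<rho> x \<ge> 0"
    and \<mu>: "\<mu> = density lborel (\<lambda>x. ennreal (\<rho> x))" and iv: "is_interval (spt \<mu>)"
    and pos: "\<And>x. x \<in> interior (spt \<mu>) \<Longrightarrow> \<rho> x > 0" and diff: "\<rho> differentiable_on spt \<mu>"
    using st by (auto simp: standing_def)
  have sub: "spt \<mu> \<subseteq> {a..b}"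
    using AE_bounds by (intro spt_subset_closed) auto
  have sptAE: "AE x in \<mu>. x \<in> spt \<mu>" by (rule AE_in_spt) simp
  then have ne: "spt \<mu> \<noteq> {}" by auto
  have bdd: "bdd_below (spt \<mu>)" "bdd_above (spt \<mu>)" using sub by (meson bdd_below_Icc bdd_above_Icc bdd_below_mono bdd_above_mono)+
  define c where "c = Inf (spt \<mu>)"
  define d where "d = Sup (spt \<mu>)"
  have cd: "c \<in> spt \<mu>" "d \<in> spt \<mu>"
    unfolding c_def d_def using closed_contains_Inf[OF ne bdd(1) closed_spt] closed_contains_Sup[OF ne bdd(2) closed_spt] by auto
  have spt: "spt \<mu> = {c..d}"
  proof
    show "spt \<mu> \<subseteq> {c..d}" using bdd by (auto simp: c_def d_def intro: cInf_lower cSup_upper)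
    show "{c..d} \<subseteq> spt \<mu>" using mem_is_interval_1_I[OF iv cd] by auto
  qed
  \<comment> \<open>A lower bound on the density is a lower bound on the slope of the cdf.\<close>
  have lb: "e * (t - s) \<le> cdf \<mu> t - cdf \<mu> s"
    if "s \<le> t" "e \<ge> 0" and e: "\<And>x. s < x \<Longrightarrow> x \<le> t \<Longrightarrow> e \<le> \<rho> x" for s t e
  proof (cases "s = t")
    case False
    then have st: "s < t" using that by simp
    have "ennreal (e * (t - s)) = (\<integral>\<^sup>+x. ennreal e * indicator {s<..t} x \<partial>lborel)"
      using that by (simp add: nn_integral_cmult_indicator ennreal_mult)
    also have "\<dots> \<le> (\<integral>\<^sup>+x. ennreal (\<rho> x) * indicator {s<..t} x \<partial>lborel)"
      using e by (intro nn_integral_mono) (auto split: split_indicator intro: ennreal_leI)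
    also have "\<dots> = emeasure \<mu> {s<..t}" unfolding \<mu> by (subst emeasure_density) auto
    also have "\<dots> = ennreal (cdf \<mu> t - cdf \<mu> s)" by (simp add: emeasure_eq_measure cdf_diff_eq[OF st])
    finally show ?thesis using cdf_nondecreasing[of s t] st by simp
  qed simp
  have "regular_distribution \<mu> c d"
  proof
    show "AE x in \<mu>. c \<le> x \<and> x \<le> d" using sptAE by (simp add: spt)
    have "{x} \<in> null_sets (density lborel (\<lambda>x. ennreal (\<rho> x)))" for x
      using absolutely_continuousI_density[of "\<lambda>x. ennreal (\<rho> x)" lborel] finite_imp_null_set_lborel[of "{x}"]
      by (auto simp: absolutely_continuous_def)
    then show "measure \<mu> {x} = 0" for x
      unfolding \<mu>[symmetric] by (simp add: null_sets_def measure_def)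
  next
    fix s t assume s: "c \<le> s" and st: "s < t" and t: "t \<le> d"
    \<comment> \<open>An open interval that meets the support has positive mass; the midpoint is a
      witness.\<close>
    have "(s + t) / 2 \<in> spt \<mu>" unfolding spt using s st t by auto
    moreover have "(s + t) / 2 \<in> {s<..<t}" using st by auto
    ultimately have "emeasure \<mu> {s<..<t} > 0" by (intro sptD[of "(s + t) / 2"]) auto
    then have "0 < measure \<mu> {s<..<t}" by (simp add: emeasure_eq_measure)
    also have "\<dots> \<le> measure \<mu> {s<..t}" by (intro finite_measure_mono) auto
    also have "\<dots> = cdf \<mu> t - cdf \<mu> s" by (rule cdf_diff_eq[OF st, symmetric])
    finally show "cdf \<mu> s < cdf \<mu> t" by simp
  next
    fix q assume q: "c < q" "q < d"
    then have qi: "q \<in> interior (spt \<mu>)" by (simp add: spt)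
    define e where "e = \<rho> q / 2"
    have e: "0 < e" using pos[OF qi] by (simp add: e_def)
    have "isCont \<rho> q"
      using continuous_on_interior[OF differentiable_imp_continuous_on[OF diff] qi] .
    then have "(\<rho> \<longlongrightarrow> \<rho> q) (at q)" by (simp add: isCont_def)
    then have "\<forall>\<^sub>F x in at q. e < \<rho> x" using pos[OF qi] by (intro order_tendstoD) (auto simp: e_def)
    then obtain \<delta> where \<delta>: "\<delta> > 0" "\<And>x. x \<noteq> q \<Longrightarrow> dist x q < \<delta> \<Longrightarrow> e < \<rho> x"
      unfolding eventually_at by auto
    have near: "e \<le> \<rho> x" if "\<bar>x - q\<bar> < \<delta>" for x
      using \<delta>(2)[of x] that pos[OF qi] by (cases "x = q") (auto simp: dist_real_def e_def)
    define r where "r = \<delta> / 2"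
    have r: "0 < r" "r < \<delta>" using \<delta> by (auto simp: r_def)
    \<comment> \<open>Within distance \<open>r\<close> of \<open>q\<close> the slope
      \<open>e\<close> gives the first term. Farther away the cdf has moved by at least
      \<open>e * r\<close> while the distance is at most \<open>d - c\<close>, which gives the
      second.\<close>
    define K where "K = 1 / e + (d - c) / (e * r)"
    have K: "K > 0" using e r q by (auto simp: K_def intro!: add_pos_pos divide_pos_pos mult_pos_pos)
    have bound: "u \<le> K * F" if "0 \<le> u" "u \<le> d - c" "e * min u r \<le> F" for u F
    proof (cases "u \<le> r")
      case True
      then have F: "e * u \<le> F" using that by simp
      then have F0: "0 \<le> F" using order_trans[OF mult_nonneg_nonneg[of e u]] e that(1) by simp
      have "u = (1 / e) * (e * u)" using e by simp
      also have "\<dots> \<le> (1 / e) * F" using F e by (intro mult_left_mono) auto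
      also have "\<dots> \<le> K * F" using F0 e r q by (intro mult_right_mono) (simp_all add: K_def)
      finally show ?thesis .
    next
      case False
      then have F: "e * r \<le> F" using that by simp
      then have F0: "0 \<le> F" using order_trans[OF mult_nonneg_nonneg[of e r]] e r by simp
      have "u \<le> d - c" by fact
      also have "\<dots> = (d - c) / (e * r) * (e * r)" using e r by simp
      also have "\<dots> \<le> (d - c) / (e * r) * F" using F e r q by (intro mult_left_mono) auto
      also have "\<dots> \<le> K * F" using F0 e by (intro mult_right_mono) (simp_all add: K_def)
      finally show ?thesis .
    qed
    have "\<bar>x - q\<bar> \<le> K * \<bar>cdf \<mu> x - cdf \<mu> q\<bar>" if x: "c \<le> x" "x \<le> d" for x
    proof (rule bound)
      show "\<bar>x - q\<bar> \<le> d - c" using x q by auto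
      show "e * min \<bar>x - q\<bar> r \<le> \<bar>cdf \<mu> x - cdf \<mu> q\<bar>"
      proof (cases "q \<le> x")
        case True
        \<comment> \<open>Stop at distance \<open>r\<close>, where the density bound is still
          available; beyond it the cdf is merely monotone.\<close>
        define x' where "x' = min x (q + r)"
        have "e * (x' - q) \<le> cdf \<mu> x' - cdf \<mu> q"
          using True r e by (intro lb near) (auto simp: x'_def)
        also have "cdf \<mu> x' \<le> cdf \<mu> x" by (intro cdf_nondecreasing) (simp add: x'_def)
        finally have "e * (x' - q) \<le> \<bar>cdf \<mu> x - cdf \<mu> q\<bar>" by simp
        moreover have "x' - q = min \<bar>x - q\<bar> r" using True by (auto simp: x'_def)
        ultimately show ?thesis by simp
      next
        case False
        define x' where "x' = max x (q - r)"
        have "e * (q - x') \<le> cdf \<mu> q - cdf \<mu> x'"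
          using False r e by (intro lb near) (auto simp: x'_def)
        moreover have "cdf \<mu> x \<le> cdf \<mu> x'" by (intro cdf_nondecreasing) (simp add: x'_def)
        ultimately have "e * (q - x') \<le> \<bar>cdf \<mu> x - cdf \<mu> q\<bar>" by simp
        moreover have "q - x' = min \<bar>x - q\<bar> r" using False by (auto simp: x'_def)
        ultimately show ?thesis by simp
      qed
    qed simp
    with K show "\<exists>K>0. \<forall>x. c \<le> x \<longrightarrow> x \<le> d \<longrightarrow> \<bar>x - q\<bar> \<le> K * \<bar>cdf \<mu> x - cdf \<mu> q\<bar>" by blast
  qed
  then show ?thesis by (rule that)
qed

section \<open>Constants valid for every sample size, and the final estimates\<close>

text \<open>The finitely many early values go into the constant: \<open>S\<close> dominates each
  \<open>\<bar>f n\<bar> * sqrt n\<close> with \<open>n < N\<close>, and \<open>R \<ge> 0\<close>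
  means that adding \<open>R\<close> does no harm.\<close>

lemma eventually_bound_imp_bound:
  fixes f :: "nat \<Rightarrow> real"
  assumes R: "0 \<le> R" and ev: "\<forall>\<^sub>F n in sequentially. f n \<le> R + C / sqrt (real n)"
  shows "\<exists>C>0. \<forall>n\<ge>1. f n \<le> R + C / sqrt (real n)"
proof -
  obtain N where N: "\<And>n. n \<ge> N \<Longrightarrow> f n \<le> R + C / sqrt (real n)"
    using ev by (auto simp: eventually_sequentially)
  define S where "S = (\<Sum>n<N. \<bar>f n\<bar> * sqrt (real n))"
  have S: "0 \<le> S" unfolding S_def by (intro sum_nonneg) auto
  define C' where "C' = 1 + \<bar>C\<bar> + S"
  have "f n \<le> R + C' / sqrt (real n)" if n: "n \<ge> 1" for n
  proof (cases "n < N")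
    case True
    have "\<bar>f n\<bar> * sqrt (real n) \<le> S"
      unfolding S_def using True by (intro member_le_sum) auto
    also have "S \<le> C'" by (simp add: C'_def)
    finally have "\<bar>f n\<bar> \<le> C' / sqrt (real n)" using n by (simp add: field_simps)
    with R show ?thesis by linarith
  next
    case False
    have "C / sqrt (real n) \<le> C' / sqrt (real n)"
      using S by (intro divide_right_mono) (auto simp: C'_def)
    then show ?thesis using N[of n] False by simp
  qed
  moreover have "0 < C'" using S by (simp add: C'_def)
  ultimately show ?thesis by blast
qed

text \<open>The existence of the limit is part of the conclusion, and \<open>C\<close> is chosen
  before \<open>n\<close>, which is stronger than letting it depend on \<open>n\<close>.\<close>

theorem theorem9:
  fixes \<mu> \<mu>' \<nu> \<nu>' :: "real measure" and \<rho> :: "real \<Rightarrow> real"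
    and a b :: real and k :: nat and y y' :: "nat \<Rightarrow> real"
  assumes "a \<le> b" and "k \<ge> 1"
    and "standing \<mu> \<rho>" and "emeasure \<mu> {a..b} = 1"
    and "prob_space \<mu>'" and "sets \<mu>' = sets borel" and "emeasure \<mu>' {a..b} = 1"
    and "W1_opt_k k \<mu> \<nu>" and "support_points k \<nu> y"
    and "W1_opt_k k \<mu>' \<nu>'" and "support_points k \<nu>' y'"
  defines "v \<equiv> (\<lambda>j. cdf \<mu> (y j))" and "v' \<equiv> (\<lambda>j. cdf \<mu>' (y' j))"
  shows "(\<exists>L. (\<lambda>n. \<bar>Bar n k \<mu> v' - 1\<bar>) \<longlonglongrightarrow> L \<and>
            L \<le> (Winf \<mu> \<mu>' + 2 * W1 \<mu> \<mu>') / W1 \<mu> \<nu> \<and>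
            (Winf \<mu> \<mu>' + 2 * W1 \<mu> \<mu>') / W1 \<mu> \<nu> \<le> 3 * Winf \<mu> \<mu>' / W1 \<mu> \<nu>)
       \<and> (\<exists>C>0. \<forall>n>k. \<bar>Bar n k \<mu> v - Bar n k \<mu> v'\<bar>
                         \<le> 3 * Winf \<mu> \<mu>' / W1 \<mu> \<nu> + C / sqrt (real n))"
proof -
  note k = \<open>k \<ge> 1\<close>
  have bd: "bounded_distribution M a b"
    if "prob_space M" "sets M = sets borel" "emeasure M {a..b} = 1" for M
  proof -
    interpret prob_space M by fact
    have "AE x in M. x \<in> {a..b}"
      by (rule AE_prob_1) (use that in \<open>simp add: emeasure_eq_measure\<close>)
    then show ?thesis
      using that by (auto simp: bounded_distribution_def bounded_distribution_axioms_def
          real_distribution_def real_distribution_axioms_def)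
  qed
  have \<mu>: "prob_space \<mu>" "sets \<mu> = sets borel" using assms(3) by (auto simp: standing_def)
  have b: "bounded_distribution \<mu> a b" "bounded_distribution \<mu>' a b"
    using bd \<mu> assms by auto
  interpret M: bounded_distribution \<mu> a b by (rule b)
  interpret N: bounded_distribution \<mu>' a b by (rule b)
  \<comment> \<open>Two intervals for \<mu>: [a, b] is shared with \<mu>' and serves transport,
    [c, d] is its own support and serves quantiles.\<close>
  obtain c d where "regular_distribution \<mu> c d" by (rule standing_regular[OF assms(3) b(1)])
  then interpret R: regular_distribution \<mu> c d .
  note opt = M.W1_opt_k_cost[OF k assms(8,9)] and opt' = N.W1_opt_k_cost[OF k assms(10,11)]
  have v: "0 \<le> v j \<and> v j \<le> 1" for j
    using M.cdf_nonneg M.cdf_bounded_prob by (simp add: v_def)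
  have v': "0 \<le> v' j \<and> v' j \<le> 1" for j
    using N.cdf_nonneg N.cdf_bounded_prob by (simp add: v'_def)
  have "\<forall>j. \<exists>q. c \<le> q \<and> q \<le> d \<and> cdf \<mu> q = v j"
    using v by (intro allI R.quantile_ex) auto
  from choice[OF this] obtain q where q: "\<And>j. c \<le> q j \<and> q j \<le> d \<and> cdf \<mu> (q j) = v j"
    by blast
  have "\<forall>j. \<exists>q. c \<le> q \<and> q \<le> d \<and> cdf \<mu> q = v' j"
    using v' by (intro allI R.quantile_ex) auto
  from choice[OF this] obtain q' where q': "\<And>j. c \<le> q' j \<and> q' j \<le> d \<and> cdf \<mu> (q' j) = v' j"
    by blast
  define w where "w = W1 \<mu> \<nu>"
  have w: "w = cost \<mu> k y" "w > 0" using opt(1) R.cost_pos[OF k, of y] by (auto simp: w_def)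
  define B where "B = Winf \<mu> \<mu>' + 2 * W1 \<mu> \<mu>'"
  have B: "0 \<le> B" "B \<le> 3 * Winf \<mu> \<mu>'"
    using W1_le_Winf[OF b] W1_nonneg[of \<mu> \<mu>'] by (auto simp: B_def)
  have cq: "cost \<mu> k q \<le> w"
    unfolding w(1) by (rule R.cost_own_quantiles_le[OF k opt(2)]) (use q in \<open>simp add: v_def\<close>)
  have cq': "cost \<mu> k q' \<le> w + B"
    unfolding w(1) B_def
    by (rule R.cost_quantiles_le[OF k b opt'(2)]) (use q' in \<open>simp add: v'_def\<close>)
  have Bw: "B / w \<le> 3 * Winf \<mu> \<mu>' / w" using B w by (intro divide_right_mono) auto
  have "(\<lambda>n. \<bar>Bar n k \<mu> v' - 1\<bar>) \<longlonglongrightarrow> \<bar>cost \<mu> k q' / w - 1\<bar>"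
    unfolding w(1) by (intro tendsto_intros R.Bar_tendsto[OF k opt(2) v' q'])
  moreover have "\<bar>cost \<mu> k q' / w - 1\<bar> \<le> B / w"
  proof -
    have "cost \<mu> k q' / w - 1 = (cost \<mu> k q' - w) / w" using w(2) by (simp add: diff_divide_distrib)
    \<comment> \<open>By optimality of \<open>y\<close> the limiting ratio is at least 1, so the
      absolute value drops.\<close>
    moreover have "0 \<le> (cost \<mu> k q' - w) / w" using opt(2)[of q'] w by simp
    moreover have "(cost \<mu> k q' - w) / w \<le> B / w" using cq' w(2) by (intro divide_right_mono) auto
    ultimately show ?thesis by simp
  qed
  ultimately have 1: "\<exists>L. (\<lambda>n. \<bar>Bar n k \<mu> v' - 1\<bar>) \<longlonglongrightarrow> L \<and> L \<le> B / w \<and> B / w \<le> 3 * Winf \<mu> \<mu>' / w"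
    using Bw by blast
  obtain C where C: "\<forall>\<^sub>F n in sequentially. Bar n k \<mu> v - 1 \<le> (cost \<mu> k q - w) / w + C / sqrt (real n)"
    using R.Bar_rate[of k y v q, OF k opt(2) v q] unfolding w(1) by blast
  obtain C' where C': "\<forall>\<^sub>F n in sequentially. Bar n k \<mu> v' - 1 \<le> (cost \<mu> k q' - w) / w + C' / sqrt (real n)"
    using R.Bar_rate[of k y v' q', OF k opt(2) v' q'] unfolding w(1) by blast
  \<comment> \<open>Both ratios are eventually at least 1, so their distance is at most the larger
    excess over 1. For \<open>v\<close> this excess is only \<open>C / sqrt n\<close>, because
    \<open>cost \<mu> k q \<le> w\<close>.\<close>
  have "\<forall>\<^sub>F n in sequentially. \<bar>Bar n k \<mu> v - Bar n k \<mu> v'\<bar> \<le> 3 * Winf \<mu> \<mu>' / w + (\<bar>C\<bar> + \<bar>C'\<bar>) / sqrt (real n)"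
    using C C' R.Bar_ge_1[of k y v, OF k opt(2) v] R.Bar_ge_1[of k y v', OF k opt(2) v']
  proof eventually_elim
    case (elim n)
    have "(cost \<mu> k q - w) / w \<le> 0" using cq w by (simp add: divide_le_0_iff)
    moreover have "(cost \<mu> k q' - w) / w \<le> B / w" using cq' w by (intro divide_right_mono) auto
    moreover have "C / sqrt (real n) \<le> (\<bar>C\<bar> + \<bar>C'\<bar>) / sqrt (real n)"
      "C' / sqrt (real n) \<le> (\<bar>C\<bar> + \<bar>C'\<bar>) / sqrt (real n)"
      by (intro divide_right_mono; simp)+
    moreover have "0 \<le> B / w" using B w by simp
    ultimately show ?case using elim Bw unfolding abs_le_iff by linarith
  qed
  then have "\<exists>C>0. \<forall>n\<ge>1. \<bar>Bar n k \<mu> v - Bar n k \<mu> v'\<bar> \<le> 3 * Winf \<mu> \<mu>' / w + C / sqrt (real n)"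
    using B w by (intro eventually_bound_imp_bound) auto
  then have "\<exists>C>0. \<forall>n>k. \<bar>Bar n k \<mu> v - Bar n k \<mu> v'\<bar> \<le> 3 * Winf \<mu> \<mu>' / w + C / sqrt (real n)"
    using k by (meson less_imp_le order_trans)
  with 1 show ?thesis unfolding B_def w_def by blast
qed

end
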